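(* Let $M\subseteq F$ be a finitely generated graded $A$-module generated in degrees less than or equal to $a$. If $\operatorname{in}_{(\omega,\epsilon)}(M)$ has no minimal generators in degrees $a+1,\dots,a+1+\operatorname{creg}(\operatorname{in}_{(\omega,\epsilon)}(M))$, then $\operatorname{in}_{(\omega,\epsilon)}(M)$ is generated in degrees less than or equal to $a$.
   Context: $K$ is a field, $A=K[X_1,\dots,X_n]$ is a standard graded polynomial ring with homogeneous maximal ideal $\mathbf m$, $\omega=(w_1,\dots,w_n)\in\mathbb Z_{\ge 0}^n$ is a weight, $F=\bigoplus_{j=1}^m A(-d_j)=\bigoplus_{j=1}^m Ae_j$ is a free graded $A$-module with basis $e_1,\dots,e_m$ of degrees $d_1,\dots,d_m$, and $\epsilon=(\epsilon_1,\dots,\epsilon_m)$ is a vector of non-negative integers. The weight of the monomial $\mathbf X^{\mathbf u}e_j\in F$ is $\omega\cdot\mathbf u+\epsilon_j$. For $0\ne f\in F$, $\operatorname{in}_{(\omega,\epsilon)}(f)$ is the sum of all terms (monomials with their coefficients) of $f$ of largest weight, and for a submodule $M\subseteq F$, $\operatorname{in}_{(\omega,\epsilon)}(M)$ is the submodule of $F$ generated by all $\operatorname{in}_{(\omega,\epsilon)}(f)$, $f\in M$. "$M\subseteq F$ graded" means a graded submodule. For a finitely generated graded $A$-module $N$ and $a\in\mathbb Z$, let $N_{\langle a\rangle}=\bigoplus_{d\ge 0}\mathbf m^dN_a$ be the submodule generated by the degree-$a$ component $N_a$. $N$ is $r$-componentwise regular if $\operatorname{reg}(N_{\langle a\rangle})\le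 a+r$ for all $a$, where $\operatorname{reg}$ is Castelnuovo–Mumford regularity over $A$; the componentwise regularity $\operatorname{creg}(N)$ is the infimum of all $r$ such that $N$ is $r$-componentwise regular. *)

theory Defs
  imports "HOL-Library.Poly_Mapping" "HOL-Library.Extended_Real"
begin

text \<open>
  The polynomial ring \<open>A = K[X_1,\<dots>,X_n]\<close> is \<open>('n, 'k) mpol\<close>: the variables are indexed by the
  finite type \<open>'n\<close>, and a polynomial maps exponent vectors to coefficients; its multiplication is
  the convolution product of \<^theory>\<open>HOL-Library.Poly_Mapping\<close>. Vectors with polynomial entries are
  finitely supported sequences. A list \<open>d = [d_0, \<dots>, d_{m-1}]\<close> of integers stands for the graded
  free module \<open>F = \<Oplus>\<^sub>j A(-d_j)\<close>, whose elements are the vectors supported on the indices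
  \<open>j < m\<close>. Thus free modules of every finite rank live in one type, as resolutions require.
\<close>

type_synonym ('n, 'k) mpol = "('n \<Rightarrow>\<^sub>0 nat) \<Rightarrow>\<^sub>0 'k"
type_synonym ('n, 'k) fvec = "nat \<Rightarrow>\<^sub>0 ('n, 'k) mpol"

definition fscale :: "('n, 'k::field) mpol \<Rightarrow> ('n, 'k) fvec \<Rightarrow> ('n, 'k) fvec" where
  "fscale p f = Poly_Mapping.map (\<lambda>q. p * q) f"

lemma lookup_fscale: "Poly_Mapping.lookup (fscale p f) j = p * Poly_Mapping.lookup f j"
  unfolding fscale_def by (simp add: Poly_Mapping.map.rep_eq when_def)

interpretation fmod: module fscale
  by unfold_locales
    (auto intro!: poly_mapping_eqI simp: lookup_fscale lookup_add algebra_simps)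

definition free_mod :: "int list \<Rightarrow> ('n, 'k::field) fvec set" where
  "free_mod d = {f. Poly_Mapping.keys f \<subseteq> {..<length d}}"

text \<open>The pair \<open>(j, u)\<close> encodes the monomial \<open>X^u e_j\<close>.\<close>

definition monoms :: "('n, 'k::field) fvec \<Rightarrow> (nat \<times> ('n \<Rightarrow>\<^sub>0 nat)) set" where
  "monoms f = {(j, u). Poly_Mapping.lookup (Poly_Mapping.lookup f j) u \<noteq> 0}"

definition terms_where ::
    "(nat \<times> ('n \<Rightarrow>\<^sub>0 nat) \<Rightarrow> bool) \<Rightarrow> ('n, 'k::field) fvec \<Rightarrow> ('n, 'k) fvec" where
  "terms_where P f =
     (\<Sum>(j, u) \<in> {x \<in> monoms f. P x}.
        Poly_Mapping.single j
          (Poly_Mapping.single u (Poly_Mapping.lookup (Poly_Mapping.lookup f j) u)))"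

fun mon_deg :: "int list \<Rightarrow> nat \<times> ('n::finite \<Rightarrow>\<^sub>0 nat) \<Rightarrow> int" where
  "mon_deg d (j, u) = int (\<Sum>i\<in>UNIV. Poly_Mapping.lookup u i) + d ! j"

fun mon_weight :: "('n::finite \<Rightarrow> nat) \<Rightarrow> nat list \<Rightarrow> nat \<times> ('n \<Rightarrow>\<^sub>0 nat) \<Rightarrow> nat" where
  "mon_weight \<omega> \<epsilon> (j, u) = (\<Sum>i\<in>UNIV. \<omega> i * Poly_Mapping.lookup u i) + \<epsilon> ! j"


section \<open>Graded submodules\<close>

definition homog :: "int list \<Rightarrow> int \<Rightarrow> ('n::finite, 'k::field) fvec set" where
  "homog d t = {f \<in> free_mod d. \<forall>x \<in> monoms f. mon_deg d x = t}"

definition graded_submodule :: "int list \<Rightarrow> ('n::finite, 'k::field) fvec set \<Rightarrow> bool" where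
  "graded_submodule d N \<longleftrightarrow>
     fmod.subspace N \<and> N \<subseteq> free_mod d \<and>
     (\<forall>f \<in> N. \<forall>t. terms_where (\<lambda>x. mon_deg d x = t) f \<in> N)"

definition finitely_generated :: "('n, 'k::field) fvec set \<Rightarrow> bool" where
  "finitely_generated N \<longleftrightarrow> (\<exists>G. finite G \<and> fmod.span G = N)"

definition generated_in_degrees_le ::
    "int list \<Rightarrow> ('n::finite, 'k::field) fvec set \<Rightarrow> int \<Rightarrow> bool" where
  "generated_in_degrees_le d N a \<longleftrightarrow> fmod.span (\<Union>t\<in>{..a}. N \<inter> homog d t) = N"

definition minimal_generators ::
    "int list \<Rightarrow> ('n::finite, 'k::field) fvec set \<Rightarrow> ('n, 'k) fvec set \<Rightarrow> bool" where
  "minimal_generators d N G \<longleftrightarrow>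
     G \<subseteq> (\<Union>t. homog d t) \<and> fmod.span G = N \<and> (\<forall>H. H \<subset> G \<longrightarrow> fmod.span H \<noteq> N)"

definition has_minimal_generator_in_degree ::
    "int list \<Rightarrow> ('n::finite, 'k::field) fvec set \<Rightarrow> int \<Rightarrow> bool" where
  "has_minimal_generator_in_degree d N t \<longleftrightarrow>
     (\<exists>G. minimal_generators d N G \<and> G \<inter> homog d t \<noteq> {})"

text \<open>The submodule \<open>N\<^bsub>\<langle>a\<rangle>\<^esub>\<close> generated by the degree \<open>a\<close> component.\<close>

definition component_submodule ::
    "int list \<Rightarrow> ('n::finite, 'k::field) fvec set \<Rightarrow> int \<Rightarrow> ('n, 'k) fvec set" where
  "component_submodule d N a = fmod.span (N \<inter> homog d a)"


section \<open>Initial submodules\<close>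

definition initial_form ::
    "('n::finite \<Rightarrow> nat) \<Rightarrow> nat list \<Rightarrow> ('n, 'k::field) fvec \<Rightarrow> ('n, 'k) fvec" where
  "initial_form \<omega> \<epsilon> f =
     terms_where (\<lambda>x. mon_weight \<omega> \<epsilon> x = Max (mon_weight \<omega> \<epsilon> ` monoms f)) f"

definition initial_submodule ::
    "('n::finite \<Rightarrow> nat) \<Rightarrow> nat list \<Rightarrow> ('n, 'k::field) fvec set \<Rightarrow> ('n, 'k) fvec set" where
  "initial_submodule \<omega> \<epsilon> M = fmod.span (initial_form \<omega> \<epsilon> ` (M - {0}))"


section \<open>Castelnuovo--Mumford regularity\<close>

definition irrelevant_ideal :: "('n, 'k::field) mpol set" where
  "irrelevant_ideal = {p. Poly_Mapping.lookup p 0 = 0}"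

definition irrelevant_mult :: "('n, 'k::field) fvec set \<Rightarrow> ('n, 'k) fvec set" where
  "irrelevant_mult N = fmod.span {fscale p f | p f. p \<in> irrelevant_ideal \<and> f \<in> N}"

text \<open>
  Minimal graded free resolutions
  \<open>\<cdots> \<rightarrow> F\<^sub>2 \<rightarrow> F\<^sub>1 \<rightarrow> F\<^sub>0 \<rightarrow> N \<rightarrow> 0\<close> of a graded submodule \<open>N\<close> of \<open>free_mod d\<close>:
  \<open>F\<^sub>i = free_mod (D i)\<close>, the map \<open>\<phi> 0\<close> is the augmentation onto \<open>N\<close>, and
  \<open>\<phi> (Suc i) : F\<^bsub>i+1\<^esub> \<rightarrow> F\<^sub>i\<close>. The maps \<open>\<phi> i\<close> are linear on the whole type of vectors, but only
  their restrictions to \<open>free_mod (D i)\<close> matter; every linear map on \<open>free_mod (D i)\<close> has such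
  an extension. The resolution may be padded by zero modules (\<open>D i = []\<close>).
\<close>

definition minimal_graded_free_resolution ::
    "int list \<Rightarrow> ('n::finite, 'k::field) fvec set \<Rightarrow>
     (nat \<Rightarrow> int list) \<Rightarrow> (nat \<Rightarrow> ('n, 'k) fvec \<Rightarrow> ('n, 'k) fvec) \<Rightarrow> bool" where
  "minimal_graded_free_resolution d N D \<phi> \<longleftrightarrow>
     (\<forall>i. module_hom fscale fscale (\<phi> i)) \<and>
     (\<forall>t. \<phi> 0 ` homog (D 0) t \<subseteq> homog d t) \<and>
     (\<forall>i t. \<phi> (Suc i) ` homog (D (Suc i)) t \<subseteq> homog (D i) t) \<and>
     \<phi> 0 ` free_mod (D 0) = N \<and>
     (\<forall>i. \<phi> (Suc i) ` free_mod (D (Suc i)) = {x \<in> free_mod (D i). \<phi> i x = 0}) \<and>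
     (\<forall>i. \<phi> (Suc i) ` free_mod (D (Suc i)) \<subseteq> irrelevant_mult (free_mod (D i)))"

text \<open>
  \<open>regularity d N = sup {j - i | \<beta>\<^bsub>i,j\<^esub>(N) \<noteq> 0}\<close>, where \<open>\<beta>\<^bsub>i,j\<^esub>(N)\<close> is the number of summands \<open>A(-j)\<close>
  in homological degree \<open>i\<close> of the minimal graded free resolution, which exists for graded
  submodules of \<open>free_mod d\<close> and is unique up to isomorphism. In particular the regularity of the
  zero module is \<open>-\<infinity>\<close>.
\<close>

definition betti_nonzero ::
    "int list \<Rightarrow> ('n::finite, 'k::field) fvec set \<Rightarrow> nat \<Rightarrow> int \<Rightarrow> bool" where
  "betti_nonzero d N i j \<longleftrightarrow>
     (\<exists>D \<phi>. minimal_graded_free_resolution d N D \<phi> \<and> j \<in> set (D i))"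

definition regularity :: "int list \<Rightarrow> ('n::finite, 'k::field) fvec set \<Rightarrow> ereal" where
  "regularity d N = Sup {ereal (of_int (j - int i)) | i j. betti_nonzero d N i j}"

definition componentwise_regular ::
    "int list \<Rightarrow> ('n::finite, 'k::field) fvec set \<Rightarrow> int \<Rightarrow> bool" where
  "componentwise_regular d N r \<longleftrightarrow>
     (\<forall>a. regularity d (component_submodule d N a) \<le> ereal (of_int (a + r)))"

text \<open>The infimum over all integers \<open>r\<close>; it equals \<open>-\<infinity>\<close> for the zero module.\<close>

definition creg :: "int list \<Rightarrow> ('n::finite, 'k::field) fvec set \<Rightarrow> ereal" where
  "creg d N = Inf {ereal (of_int r) | r. componentwise_regular d N r}"

end

theory Submission
  imports Defs
begin

text \<open>
  Write \<open>N\<close> for the initial submodule of \<open>M\<close>, let \<open>r\<close> be its componentwise regularity, and let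
  \<open>C\<close> be the submodule generated by the component of \<open>N\<close> in degree \<open>a\<close>. The gap in the degrees of the minimal
  generators says that \<open>N\<close> and \<open>C\<close> agree in the degrees from \<open>a\<close> to \<open>a + r + 1\<close>, and the claim
  is that they agree in all degrees from \<open>a\<close> on. This is Buchberger's criterion.

  Choose elements \<open>h\<^sub>1, \<dots>, h\<^sub>s\<close> of degree \<open>a\<close> in \<open>M\<close> whose initial forms are minimal
  generators of \<open>C\<close>. Dividing by the \<open>h\<^sub>i\<close> shows that they generate the component of \<open>M\<close> in degree \<open>a\<close>,
  and hence, as \<open>M\<close> is generated in degrees at most \<open>a\<close>, everything in \<open>M\<close> from degree \<open>a\<close> on.
  Now write an element of \<open>M\<close> of degree at least \<open>a\<close> as a combination of the \<open>h\<^sub>i\<close>. If the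
  terms of largest weight do not cancel, they form its initial form, which therefore lies in
  \<open>C\<close>. If they do, their coefficients form a syzygy of the initial forms of the \<open>h\<^sub>i\<close>. Because \<open>C\<close>
  has regularity at most \<open>a + r\<close>, these syzygies are generated in degrees at most \<open>a + r + 1\<close>
  (\<open>syzygies_generated_by_regularity\<close>). In these degrees \<open>N\<close> and \<open>C\<close> agree, so the combination of the
  \<open>h\<^sub>i\<close> given by such a generator, which has lost its top weight, can be divided by the \<open>h\<^sub>i\<close>
  without exceeding its own weight (\<open>reduction\<close>). Thus each syzygy
  can be traded for a combination of smaller weight (\<open>syzygies_lift\<close>), and induction on the
  weight finishes the argument (\<open>initial_form_lincomb_in_span\<close>).

  Regularity is a supremum over minimal graded free resolutions and bounds something only if
  there is one. Hence resolutions are constructed, with prescribed minimal generators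
  in the first step (\<open>minimal_resolution_extends_generators\<close>); this rests on Hilbert's basis theorem
  for graded submodules (\<open>graded_submodule_finitely_generated\<close>). The resolutions may be
  infinite, so the componentwise regularity may a priori be infinite as well; then the hypothesis
  excludes minimal generators in every degree above \<open>a\<close>. It is \<open>-\<infinity>\<close> only for \<open>N = 0\<close>,
  where nothing is to be shown.
\<close>

section \<open>Terms of vectors of polynomials\<close>

abbreviation fterm :: "nat \<Rightarrow> ('n \<Rightarrow>\<^sub>0 nat) \<Rightarrow> 'k::field \<Rightarrow> ('n, 'k) fvec" where
  "fterm j u c \<equiv> Poly_Mapping.single j (Poly_Mapping.single u c)"

lemma finite_monoms: "finite (monoms f)"
proof -
  have "monoms f = (SIGMA j:Poly_Mapping.keys f. Poly_Mapping.keys (Poly_Mapping.lookup f j))"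
    by (auto simp: monoms_def in_keys_iff)
  then show ?thesis by simp
qed

lemma mem_monoms:
  "(j, u) \<in> monoms f \<longleftrightarrow> Poly_Mapping.lookup (Poly_Mapping.lookup f j) u \<noteq> 0"
  by (simp add: monoms_def)

lemma lookup_fterm:
  "Poly_Mapping.lookup (Poly_Mapping.lookup (fterm j u c) i) v = (if i = j \<and> v = u then c else 0)"
  by (auto simp: lookup_single when_def)

lemma lookup_terms_where:
  "Poly_Mapping.lookup (Poly_Mapping.lookup (terms_where P f) j) u =
     (if P (j, u) then Poly_Mapping.lookup (Poly_Mapping.lookup f j) u else 0)"
proof -
  have fin: "finite {x \<in> monoms f. P x}" by (simp add: finite_monoms)
  have "Poly_Mapping.lookup (Poly_Mapping.lookup (terms_where P f) j) u =
      (\<Sum>x\<in>{x \<in> monoms f. P x}. if x = (j, u)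
         then Poly_Mapping.lookup (Poly_Mapping.lookup f j) u else 0)"
    unfolding terms_where_def lookup_sum
    by (intro sum.cong refl) (auto simp: lookup_fterm split: prod.splits)
  also have "\<dots> = (if P (j, u) then Poly_Mapping.lookup (Poly_Mapping.lookup f j) u else 0)"
    using fin by (auto simp: sum.delta' mem_monoms)
  finally show ?thesis .
qed

lemma fvec_eqI:
  assumes "\<And>j u. Poly_Mapping.lookup (Poly_Mapping.lookup f j) u
      = Poly_Mapping.lookup (Poly_Mapping.lookup g j) u"
  shows "f = g"
  using assms by (intro poly_mapping_eqI) auto

lemma monoms_terms_where: "monoms (terms_where P f) = {x \<in> monoms f. P x}"
  by (auto simp: mem_monoms lookup_terms_where split: if_splits)

lemma monoms_zero [simp]: "monoms 0 = {}"
  by (auto simp: mem_monoms)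

lemma monoms_eq_empty [simp]: "monoms f = {} \<longleftrightarrow> f = 0"
proof
  assume *: "monoms f = {}"
  show "f = 0"
  proof (rule fvec_eqI, goal_cases)
    case (1 j u)
    then show ?case using * mem_monoms[of j u f] by simp
  qed
qed simp

lemma monoms_add: "monoms (f + g) \<subseteq> monoms f \<union> monoms g"
  by (auto simp: mem_monoms lookup_add)

lemma monoms_diff: "monoms (f - g) \<subseteq> monoms f \<union> monoms g"
  by (auto simp: mem_monoms lookup_minus)

lemma monoms_fterm: "monoms (fterm j u c) \<subseteq> {(j, u)}"
  by (auto simp: mem_monoms lookup_fterm split: if_splits)

lemma terms_where_zero [simp]: "terms_where P 0 = 0"
  by (rule fvec_eqI) (simp add: lookup_terms_where)

lemma terms_where_add: "terms_where P (f + g) = terms_where P f + terms_where P g"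
  by (rule fvec_eqI) (simp add: lookup_terms_where lookup_add)

lemma terms_where_diff: "terms_where P (f - g) = terms_where P f - terms_where P g"
  by (rule fvec_eqI) (simp add: lookup_terms_where lookup_minus)

lemma terms_where_fterm: "terms_where P (fterm j u c) = (if P (j, u) then fterm j u c else 0)"
  by (rule fvec_eqI) (auto simp: lookup_terms_where lookup_fterm)

lemma terms_where_terms_where:
  "terms_where P (terms_where Q f) = terms_where (\<lambda>x. P x \<and> Q x) f"
  by (rule fvec_eqI) (auto simp: lookup_terms_where)

lemma terms_where_cong:
  assumes "\<And>x. x \<in> monoms f \<Longrightarrow> P x = Q x"
  shows "terms_where P f = terms_where Q f"
proof (rule fvec_eqI, goal_cases)
  case (1 j u)
  then show ?case using assms[of "(j, u)"] by (auto simp: lookup_terms_where mem_monoms)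
qed

lemma terms_where_id:
  assumes "\<And>x. x \<in> monoms f \<Longrightarrow> P x"
  shows "terms_where P f = f"
proof (rule fvec_eqI, goal_cases)
  case (1 j u)
  then show ?case using assms[of "(j, u)"] by (auto simp: lookup_terms_where mem_monoms)
qed

lemma terms_where_none:
  assumes "\<And>x. x \<in> monoms f \<Longrightarrow> \<not> P x"
  shows "terms_where P f = 0"
proof (rule fvec_eqI, goal_cases)
  case (1 j u)
  then show ?case using assms[of "(j, u)"] by (auto simp: lookup_terms_where mem_monoms)
qed

lemma sum_terms_where_fibres:
  assumes "finite T" "\<gamma> ` monoms f \<subseteq> T"
  shows "(\<Sum>t\<in>T. terms_where (\<lambda>x. \<gamma> x = t) f) = f"
proof (rule fvec_eqI)
  fix j u
  have "Poly_Mapping.lookup (Poly_Mapping.lookup (\<Sum>t\<in>T. terms_where (\<lambda>x. \<gamma> x = t) f) j) u =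
      (\<Sum>t\<in>T. if t = \<gamma> (j, u) then Poly_Mapping.lookup (Poly_Mapping.lookup f j) u else 0)"
    unfolding lookup_sum by (intro sum.cong refl) (auto simp: lookup_terms_where)
  also have "\<dots> = Poly_Mapping.lookup (Poly_Mapping.lookup f j) u"
    using assms by (auto simp: sum.delta mem_monoms image_subset_iff)
  finally show "Poly_Mapping.lookup (Poly_Mapping.lookup
      (\<Sum>t\<in>T. terms_where (\<lambda>x. \<gamma> x = t) f) j) u = Poly_Mapping.lookup (Poly_Mapping.lookup f j) u" .
qed

lemma fvec_induct [case_names zero add fterm]:
  assumes "Q 0" "\<And>f g. Q f \<Longrightarrow> Q g \<Longrightarrow> Q (f + g)"
    and "\<And>j u c. (j, u) \<in> monoms f \<Longrightarrow> Q (fterm j u c)"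
  shows "Q f"
proof -
  have "Q (\<Sum>(j, u)\<in>X. fterm j u (Poly_Mapping.lookup (Poly_Mapping.lookup f j) u))"
    if "finite X" "X \<subseteq> monoms f" for X
    using that by induction (auto intro!: assms)
  from this[OF finite_monoms subset_refl]
  have "Q (terms_where (\<lambda>_. True) f)" by (simp add: terms_where_def)
  then show ?thesis by (simp add: terms_where_id)
qed

lemma mpol_induct [case_names zero add single]:
  fixes p :: "('n, 'k::field) mpol"
  assumes "Q 0" "\<And>p q. Q p \<Longrightarrow> Q q \<Longrightarrow> Q (p + q)"
    and "\<And>u c. u \<in> Poly_Mapping.keys p \<Longrightarrow> Q (Poly_Mapping.single u c)"
  shows "Q p"
proof -
  have "Q (\<Sum>u\<in>X. Poly_Mapping.single u (Poly_Mapping.lookup p u))"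
    if "finite X" "X \<subseteq> Poly_Mapping.keys p" for X
    using that by induction (auto intro!: assms)
  from this[OF finite_keys subset_refl]
  have "Q (\<Sum>u\<in>Poly_Mapping.keys p. Poly_Mapping.single u (Poly_Mapping.lookup p u))" .
  also have "(\<Sum>u\<in>Poly_Mapping.keys p. Poly_Mapping.single u (Poly_Mapping.lookup p u)) = p"
    by (intro poly_mapping_eqI)
       (auto simp: lookup_sum lookup_single when_def sum.delta' in_keys_iff)
  finally show ?thesis .
qed

lemma fscale_fterm:
  "fscale (Poly_Mapping.single v b) (fterm j u c) = fterm j (v + u) (b * c)"
proof (rule poly_mapping_eqI)
  fix i
  show "Poly_Mapping.lookup (fscale (Poly_Mapping.single v b) (fterm j u c)) i =
      Poly_Mapping.lookup (fterm j (v + u) (b * c)) i"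
    by (cases "i = j") (simp_all add: lookup_fscale lookup_single mult_single)
qed

lemma terms_where_fscale_single:
  "terms_where P (fscale (Poly_Mapping.single v b) f) =
     fscale (Poly_Mapping.single v b) (terms_where (\<lambda>(j, u). P (j, v + u)) f)"
  by (induction f rule: fvec_induct)
     (simp_all add: fmod.scale_right_distrib terms_where_add fscale_fterm terms_where_fterm)

lemma lookup_fscale_single:
  "Poly_Mapping.lookup (Poly_Mapping.lookup (fscale (Poly_Mapping.single v b) f) j) (v + u) =
     b * Poly_Mapping.lookup (Poly_Mapping.lookup f j) u"
  by (induction f rule: fvec_induct)
     (auto simp: fmod.scale_right_distrib lookup_add fscale_fterm lookup_fterm algebra_simps)

lemma monoms_fscale_single:
  "monoms (fscale (Poly_Mapping.single v b) f) \<subseteq> (\<lambda>(j, u). (j, v + u)) ` monoms f"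
proof -
  let ?s = "fscale (Poly_Mapping.single v b)"
  let ?X = "(\<lambda>(j, u). (j, v + u)) ` monoms f"
  have "terms_where (\<lambda>x. x \<notin> ?X) (?s f) = 0"
    unfolding terms_where_fscale_single
    by (subst terms_where_none) (auto simp: image_iff Bex_def)
  then have "{x \<in> monoms (?s f). x \<notin> ?X} = {}"
    unfolding monoms_terms_where[symmetric] by simp
  then show ?thesis by blast
qed

lemma subspaceI_monomials:
  assumes "0 \<in> S" "\<And>f g. f \<in> S \<Longrightarrow> g \<in> S \<Longrightarrow> f + g \<in> S"
    and "\<And>v c f. f \<in> S \<Longrightarrow> fscale (Poly_Mapping.single v c) f \<in> S"
  shows "fmod.subspace S"
proof (rule fmod.subspaceI)
  fix p f assume "f \<in> S"
  then show "fscale p f \<in> S"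
    by (induction p rule: mpol_induct) (auto simp: fmod.scale_left_distrib intro: assms)
qed (use assms in auto)

section \<open>Free modules and their graded submodules\<close>

lemma free_mod_iff: "f \<in> free_mod d \<longleftrightarrow> (\<forall>(j, u)\<in>monoms f. j < length d)"
proof -
  have "Poly_Mapping.keys f = fst ` monoms f"
  proof (intro equalityI subsetI)
    fix j assume "j \<in> Poly_Mapping.keys f"
    then have "Poly_Mapping.lookup f j \<noteq> 0" by (simp add: in_keys_iff)
    then obtain u where "Poly_Mapping.lookup (Poly_Mapping.lookup f j) u \<noteq> 0"
      by (metis lookup_zero poly_mapping_eqI)
    then show "j \<in> fst ` monoms f" by (force simp: monoms_def)
  qed (auto simp: monoms_def in_keys_iff)
  then show ?thesis by (auto simp: free_mod_def)
qed

lemma subspace_free_mod: "fmod.subspace (free_mod d)"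
proof (rule fmod.subspaceI)
  fix p and f :: "('a, 'b) fvec" assume "f \<in> free_mod d"
  then show "fscale p f \<in> free_mod d"
    by (auto simp: free_mod_def in_keys_iff lookup_fscale subset_iff) (metis mult_zero_right)
qed (auto simp: free_mod_def in_keys_iff lookup_add subset_iff, metis add_0_left)

lemma terms_where_free_mod: "f \<in> free_mod d \<Longrightarrow> terms_where P f \<in> free_mod d"
  by (auto simp: free_mod_iff monoms_terms_where)

lemma homog_iff: "f \<in> homog d t \<longleftrightarrow> (\<forall>(j, u)\<in>monoms f. j < length d \<and> mon_deg d (j, u) = t)"
  by (fastforce simp: homog_def free_mod_iff)

lemma homog_diff: "f \<in> homog d t \<Longrightarrow> g \<in> homog d t \<Longrightarrow> f - g \<in> homog d t"
  using monoms_diff[of f g] by (fastforce simp: homog_iff)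

lemma homog_terms_where: "f \<in> homog d t \<Longrightarrow> terms_where P f \<in> homog d t"
  by (auto simp: homog_iff monoms_terms_where)

lemma homog_part: "f \<in> free_mod d \<Longrightarrow> terms_where (\<lambda>x. mon_deg d x = t) f \<in> homog d t"
  by (auto simp: homog_iff free_mod_iff monoms_terms_where)

lemma homog_part_self: "f \<in> homog d t \<Longrightarrow> terms_where (\<lambda>x. mon_deg d x = t) f = f"
  by (intro terms_where_id) (auto simp: homog_iff)

abbreviation exp_deg :: "('n::finite \<Rightarrow>\<^sub>0 nat) \<Rightarrow> nat" where
  "exp_deg u \<equiv> \<Sum>i\<in>UNIV. Poly_Mapping.lookup u i"

lemma exp_deg_add: "exp_deg (u + v) = exp_deg u + exp_deg v"
  by (simp add: lookup_add sum.distrib)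

lemma mon_deg_shift: "mon_deg d (j, v + u) = int (exp_deg v) + mon_deg d (j, u)"
  by (simp add: lookup_add sum.distrib)

lemma mon_weight_shift:
  "mon_weight \<omega> \<epsilon> (j, v + u) = (\<Sum>i\<in>UNIV. \<omega> i * Poly_Mapping.lookup v i) + mon_weight \<omega> \<epsilon> (j, u)"
  by (simp add: lookup_add sum.distrib algebra_simps)

declare mon_deg.simps [simp del] mon_weight.simps [simp del]

lemma homog_fscale_single:
  assumes "f \<in> homog d t"
  shows "fscale (Poly_Mapping.single v c) f \<in> homog d (int (exp_deg v) + t)"
  using assms monoms_fscale_single[of v c f]
  by (fastforce simp: homog_iff mon_deg_shift)

lemma subspace_graded: "graded_submodule d N \<Longrightarrow> fmod.subspace N"
  by (simp add: graded_submodule_def)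

lemma graded_submodule_homog_part:
  "graded_submodule d N \<Longrightarrow> f \<in> N \<Longrightarrow> terms_where (\<lambda>x. mon_deg d x = t) f \<in> N \<inter> homog d t"
  unfolding graded_submodule_def using homog_part by blast

lemma graded_submodule_span:
  assumes "G \<subseteq> (\<Union>t. homog d t)"
  shows "graded_submodule d (fmod.span G)"
proof -
  let ?S = "{f \<in> fmod.span G. \<forall>t. terms_where (\<lambda>x. mon_deg d x = t) f \<in> fmod.span G}"
  have "fmod.subspace ?S"
  proof (rule subspaceI_monomials)
    fix v c f assume f: "f \<in> ?S"
    have "terms_where (\<lambda>x. mon_deg d x = t) (fscale (Poly_Mapping.single v c) f) \<in> fmod.span G" for t
    proof -
      have "terms_where (\<lambda>x. mon_deg d x = t) (fscale (Poly_Mapping.single v c) f) =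
          fscale (Poly_Mapping.single v c) (terms_where (\<lambda>x. mon_deg d x = t - int (exp_deg v)) f)"
        unfolding terms_where_fscale_single
        by (rule arg_cong[where f = "fscale _"], rule terms_where_cong) (auto simp: mon_deg_shift)
      then show ?thesis using f by (simp add: fmod.span_scale)
    qed
    then show "fscale (Poly_Mapping.single v c) f \<in> ?S"
      using f by (simp add: fmod.span_scale)
  qed (auto simp: fmod.span_zero fmod.span_add terms_where_add)
  moreover have "G \<subseteq> ?S"
  proof
    fix g assume g: "g \<in> G"
    then obtain s where s: "g \<in> homog d s" using assms by blast
    have "terms_where (\<lambda>x. mon_deg d x = t) g \<in> fmod.span G" for t
    proof (cases "t = s")
      case True then show ?thesis using g s by (simp add: homog_part_self fmod.span_base)
    next
      case False
      then have "terms_where (\<lambda>x. mon_deg d x = t) g = 0"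
        using s by (intro terms_where_none) (auto simp: homog_iff)
      then show ?thesis by (simp add: fmod.span_zero)
    qed
    then show "g \<in> ?S" using g by (simp add: fmod.span_base)
  qed
  ultimately have "fmod.span G \<subseteq> ?S" by (intro fmod.span_minimal)
  moreover have "fmod.span G \<subseteq> free_mod d"
    using assms by (intro fmod.span_minimal subspace_free_mod) (auto simp: homog_def)
  ultimately show ?thesis unfolding graded_submodule_def by auto
qed

lemma sum_homog_parts:
  "(\<Sum>t\<in>mon_deg d ` monoms f. terms_where (\<lambda>x. mon_deg d x = t) f) = f"
  by (rule sum_terms_where_fibres) (auto simp: finite_monoms)

lemma graded_submodule_subset_if_homog:
  assumes "graded_submodule d N" "fmod.subspace S" "\<And>t. N \<inter> homog d t \<subseteq> S"
  shows "N \<subseteq> S"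
proof
  fix f assume f: "f \<in> N"
  have "terms_where (\<lambda>x. mon_deg d x = t) f \<in> S" for t
    using graded_submodule_homog_part[OF assms(1) f] assms(3) by blast
  then have "(\<Sum>t\<in>mon_deg d ` monoms f. terms_where (\<lambda>x. mon_deg d x = t) f) \<in> S"
    by (intro fmod.subspace_sum[OF assms(2)])
  then show "f \<in> S" by (simp only: sum_homog_parts)
qed

section \<open>Linear combinations of a list of vectors\<close>

definition lincomb :: "('n, 'k::field) fvec list \<Rightarrow> ('n, 'k) fvec \<Rightarrow> ('n, 'k) fvec" where
  "lincomb gs x = (\<Sum>i<length gs. fscale (Poly_Mapping.lookup x i) (gs ! i))"

lemma module_hom_lincomb: "module_hom fscale fscale (lincomb gs)"
  by unfold_locales
     (simp_all add: lincomb_def lookup_add lookup_fscale fmod.scale_left_distrib sum.distrib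
        fmod.scale_sum_right)

lemmas lincomb_add = module_hom.add[OF module_hom_lincomb]
lemmas lincomb_diff = module_hom.diff[OF module_hom_lincomb]
lemmas lincomb_scale = module_hom.scale[OF module_hom_lincomb]
lemmas lincomb_zero = module_hom.zero[OF module_hom_lincomb]

lemma lincomb_fterm:
  "lincomb gs (fterm i u c) =
     (if i < length gs then fscale (Poly_Mapping.single u c) (gs ! i) else 0)"
proof -
  have "lincomb gs (fterm i u c) =
      (\<Sum>k<length gs. if k = i then fscale (Poly_Mapping.single u c) (gs ! i) else 0)"
    unfolding lincomb_def by (intro sum.cong refl) (auto simp: lookup_single when_def)
  then show ?thesis by simp
qed

lemma lincomb_image:
  assumes "length e = length gs"
  shows "lincomb gs ` free_mod e = fmod.span (set gs)"
proof
  show "lincomb gs ` free_mod e \<subseteq> fmod.span (set gs)"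
    unfolding lincomb_def
    by (intro image_subsetI fmod.span_sum fmod.span_scale fmod.span_base) simp
  have "fmod.subspace (lincomb gs ` free_mod e)"
    by (rule module_hom.subspace_image[OF module_hom_lincomb subspace_free_mod])
  moreover have "set gs \<subseteq> lincomb gs ` free_mod e"
  proof
    fix g assume "g \<in> set gs"
    then obtain i where i: "i < length gs" "g = gs ! i" by (auto simp: in_set_conv_nth)
    then have "lincomb gs (fterm i 0 1) = g"
      using lincomb_fterm[of gs i 0 1] by simp
    moreover have "fterm i 0 1 \<in> free_mod e"
      using i assms monoms_fterm[of i 0 1] by (auto simp: free_mod_iff)
    ultimately show "g \<in> lincomb gs ` free_mod e" by blast
  qed
  ultimately show "fmod.span (set gs) \<subseteq> lincomb gs ` free_mod e"
    by (rule fmod.span_minimal[rotated])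
qed

text \<open>
  A linear map preserves a grading as soon as it does so on the terms \<open>X\<^sup>u e\<^sub>i\<close>. Stated for
  predicates on monomials, this covers the degree and the weight alike.
\<close>

lemma terms_where_lincomb:
  assumes "\<And>i u j v. i < length gs \<Longrightarrow> (j, v) \<in> monoms (gs ! i) \<Longrightarrow> P' (i, u) = P (j, u + v)"
  shows "terms_where P (lincomb gs x) = lincomb gs (terms_where P' x)"
proof (induction x rule: fvec_induct)
  case zero
  then show ?case by (simp add: lincomb_zero)
next
  case (add f g)
  then show ?case by (simp add: lincomb_add terms_where_add)
next
  case (fterm i u c)
  show ?case
  proof (cases "i < length gs")
    case i: True
    show ?thesis
    proof (cases "P' (i, u)")
      case True
      then have "terms_where (\<lambda>(j, v). P (j, u + v)) (gs ! i) = gs ! i"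
        using assms[OF i] by (intro terms_where_id) auto
      then show ?thesis using i True
        by (simp add: lincomb_fterm terms_where_fterm terms_where_fscale_single)
    next
      case False
      then have "terms_where (\<lambda>(j, v). P (j, u + v)) (gs ! i) = 0"
        using assms[OF i] by (intro terms_where_none) auto
      then show ?thesis using i False
        by (simp add: lincomb_fterm terms_where_fterm terms_where_fscale_single lincomb_zero)
    qed
  qed (simp add: lincomb_fterm terms_where_fterm lincomb_zero)
qed

lemma monoms_lincomb:
  assumes "\<And>i u j v. (i, u) \<in> monoms x \<Longrightarrow> i < length gs \<Longrightarrow> (j, v) \<in> monoms (gs ! i)
      \<Longrightarrow> (j, u + v) \<in> S"
  shows "monoms (lincomb gs x) \<subseteq> S"
proof (induction x rule: fvec_induct)
  case zero
  then show ?case by (simp add: lincomb_zero)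
next
  case (add f g)
  then show ?case using monoms_add[of "lincomb gs f" "lincomb gs g"] by (auto simp: lincomb_add)
next
  case (fterm i u c)
  show ?case
  proof (cases "i < length gs")
    case True
    then have "(\<lambda>(j, v). (j, u + v)) ` monoms (gs ! i) \<subseteq> S"
      using assms[OF fterm] by auto
    then show ?thesis using True monoms_fscale_single[of u c "gs ! i"]
      by (simp add: lincomb_fterm)
  qed (simp add: lincomb_fterm)
qed

section \<open>Graded submodules are finitely generated\<close>

lemma monotone_subsequence:
  fixes s :: "nat \<Rightarrow> 'i \<Rightarrow> nat"
  assumes "finite I"
  shows "\<exists>f. strict_mono f \<and> (\<forall>i\<in>I. incseq (\<lambda>n. s (f n) i))"
  using assms
proof induction
  case empty
  show ?case using strict_mono_id by auto
next
  case (insert i I)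
  then obtain f where f: "strict_mono f" "\<And>k. k \<in> I \<Longrightarrow> incseq (\<lambda>n. s (f n) k)" by blast
  obtain g where g: "strict_mono g" "monoseq (\<lambda>n. s (f (g n)) i)"
    using seq_monosub[of "\<lambda>n. s (f n) i"] by blast
  obtain N where N: "incseq (\<lambda>n. s (f (g (n + N))) i)"
  proof (cases "incseq (\<lambda>n. s (f (g n)) i)")
    case True
    then show ?thesis using that[of 0] by simp
  next
    case False
    then have dec: "decseq (\<lambda>n. s (f (g n)) i)" using g(2) by (simp add: monoseq_iff)
    \<comment> \<open>A decreasing sequence of natural numbers is constant from the index of its least value on.\<close>
    obtain N where "\<And>n. s (f (g N)) i \<le> s (f (g n)) i"
      using ex_has_least_nat[of "\<lambda>_. True" 0 "\<lambda>n. s (f (g n)) i"] by auto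
    moreover have "s (f (g n)) i \<le> s (f (g N)) i" if "n \<ge> N" for n
      using dec that by (simp add: decseq_def)
    ultimately have "s (f (g (n + N))) i = s (f (g N)) i" for n
      by (simp add: antisym)
    then show ?thesis using that[of N] by (simp add: incseq_def)
  qed
  have mono: "strict_mono (\<lambda>n. f (g (n + N)))"
    using f(1) g(1) by (simp add: strict_mono_def)
  have "incseq (\<lambda>n. s (f (g (n + N))) k)" if "k \<in> I" for k
    using f(2)[OF that] strict_mono_mono[OF g(1)] by (simp add: incseq_def mono_def)
  then show ?case using mono N by (intro exI[of _ "\<lambda>n. f (g (n + N))"]) auto
qed

text \<open>
  Dickson's lemma. The minimal exponents of \<open>L\<close> work: infinitely many of them would
  contain a sequence along which every coordinate weakly increases, so two would be comparable.
\<close>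

lemma dickson:
  fixes L :: "('n::finite \<Rightarrow>\<^sub>0 nat) set"
  shows "\<exists>B\<subseteq>L. finite B \<and> (\<forall>u\<in>L. \<exists>v\<in>B. \<exists>w. u = w + v)"
proof -
  let ?le = "\<lambda>v u :: 'n \<Rightarrow>\<^sub>0 nat. \<forall>i. Poly_Mapping.lookup v i \<le> Poly_Mapping.lookup u i"
  define B where "B = {u \<in> L. \<forall>v\<in>L. ?le v u \<longrightarrow> v = u}"
  have "finite B"
  proof (rule ccontr)
    assume "infinite B"
    then obtain s :: "nat \<Rightarrow> 'n \<Rightarrow>\<^sub>0 nat" where s: "inj s" "range s \<subseteq> B"
      unfolding infinite_iff_countable_subset by blast
    obtain f where f: "strict_mono f"
        "\<And>i. incseq (\<lambda>n. Poly_Mapping.lookup (s (f n)) i)"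
      using monotone_subsequence[of UNIV "\<lambda>n. Poly_Mapping.lookup (s n)"] by auto
    have "?le (s (f 0)) (s (f 1))" using incseqD[OF f(2), of 0 1] by simp
    moreover have "s (f 0) \<in> B" "s (f 1) \<in> B" using s(2) by auto
    ultimately have "s (f 0) = s (f 1)" unfolding B_def by blast
    then have "f 0 = f 1" using s(1) by (simp add: inj_eq)
    then show False using strict_mono_less[OF f(1), of 0 1] by simp
  qed
  moreover have "\<exists>v\<in>B. \<exists>w. u = w + v" if u: "u \<in> L" for u
  proof -
    obtain v where v: "v \<in> L" "?le v u"
        and least: "\<And>v'. v' \<in> L \<and> ?le v' u \<Longrightarrow> exp_deg v \<le> exp_deg v'"
      using ex_has_least_nat[of "\<lambda>v. v \<in> L \<and> ?le v u" u exp_deg] u by auto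
    have "v' = v" if v': "v' \<in> L" "?le v' v" for v'
    proof (rule ccontr)
      assume "v' \<noteq> v"
      then obtain i where "Poly_Mapping.lookup v' i \<noteq> Poly_Mapping.lookup v i"
        by (meson poly_mapping_eqI)
      then have "Poly_Mapping.lookup v' i < Poly_Mapping.lookup v i"
        using v'(2) by (simp add: le_neq_implies_less)
      then have "exp_deg v' < exp_deg v"
        using v'(2) by (intro sum_strict_mono_ex1) auto
      moreover have "?le v' u" using v(2) v'(2) by (meson le_trans)
      ultimately show False using least[of v'] v'(1) by simp
    qed
    then have "v \<in> B" using v(1) by (auto simp: B_def)
    moreover have "u = (u - v) + v"
      by (rule poly_mapping_eqI) (simp add: lookup_add lookup_minus v(2))
    ultimately show ?thesis by blast
  qed
  ultimately show ?thesis by (intro exI[of _ B]) (auto simp: B_def)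
qed

text \<open>
  A monomial order on the free modules: the monomials are embedded additively, along an injection
  \<open>h\<close> of the variables into the natural numbers, into the finitely supported sequences
  of naturals, which are linearly ordered compatibly with addition.
\<close>

definition exp_key :: "('n::finite \<Rightarrow> nat) \<Rightarrow> ('n \<Rightarrow>\<^sub>0 nat) \<Rightarrow> nat \<Rightarrow>\<^sub>0 nat" where
  "exp_key h u = (\<Sum>i\<in>UNIV. Poly_Mapping.single (Suc (h i)) (Poly_Mapping.lookup u i))"

fun mon_key :: "('n::finite \<Rightarrow> nat) \<Rightarrow> nat \<times> ('n \<Rightarrow>\<^sub>0 nat) \<Rightarrow> nat \<Rightarrow>\<^sub>0 nat" where
  "mon_key h (j, u) = Poly_Mapping.single 0 j + exp_key h u"

lemma mon_key_shift: "mon_key h (j, v + u) = exp_key h v + mon_key h (j, u)"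
  by (simp add: exp_key_def lookup_add single_add sum.distrib ac_simps)

lemma inj_mon_key:
  assumes "inj h"
  shows "inj (mon_key h)"
proof (rule injI, clarify)
  fix j u j' u' assume eq: "mon_key h (j, u) = mon_key h (j', u')"
  have zero: "Poly_Mapping.lookup (mon_key h (j, u)) 0 = j" for j u
    by (simp add: exp_key_def lookup_add lookup_sum lookup_single when_def)
  have "Poly_Mapping.lookup (mon_key h (j, u)) (Suc (h i)) = Poly_Mapping.lookup u i" for j u i
  proof -
    have "Poly_Mapping.lookup (mon_key h (j, u)) (Suc (h i)) =
        (\<Sum>k\<in>UNIV. if k = i then Poly_Mapping.lookup u i else 0)"
      using assms by (simp add: exp_key_def lookup_add lookup_sum lookup_single when_def inj_eq)
    then show ?thesis by simp
  qed
  then show "j = j' \<and> u = u'"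
    using zero eq by (metis poly_mapping_eqI)
qed

declare mon_key.simps [simp del]

lemma finite_monomials_of_degree:
  "finite {(j, u :: 'n::finite \<Rightarrow>\<^sub>0 nat). j < length d \<and> mon_deg d (j, u) = t}"
proof -
  have fin: "finite {u :: 'n \<Rightarrow>\<^sub>0 nat. exp_deg u = k}" for k
  proof (rule inj_on_finite[where f = Poly_Mapping.lookup])
    show "inj_on Poly_Mapping.lookup {u :: 'n \<Rightarrow>\<^sub>0 nat. exp_deg u = k}"
      by (intro inj_onI poly_mapping_eqI) simp
    have "Poly_Mapping.lookup u i \<le> exp_deg u" for u :: "'n \<Rightarrow>\<^sub>0 nat" and i
      by (rule member_le_sum) auto
    then show "Poly_Mapping.lookup ` {u :: 'n \<Rightarrow>\<^sub>0 nat. exp_deg u = k} \<subseteq> {f. \<forall>i. f i \<le> k}"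
      by auto
    show "finite {f :: 'n \<Rightarrow> nat. \<forall>i. f i \<le> k}"
      using finite_set_of_finite_funs[of "UNIV :: 'n set" "{..k}" 0] by simp
  qed
  have "{(j, u :: 'n \<Rightarrow>\<^sub>0 nat). j < length d \<and> mon_deg d (j, u) = t} \<subseteq>
      (\<Union>j<length d. Pair j ` {u. exp_deg u = nat (t - d ! j)})"
    by (auto simp: mon_deg.simps simp del: of_nat_sum)
  then show ?thesis by (rule finite_subset) (simp add: fin)
qed

text \<open>
  Hilbert's basis theorem, for graded submodules. Dickson's lemma selects finitely many
  homogeneous elements whose leading monomials divide all leading monomials; division by them
  terminates because there are only finitely many monomials in each degree.
\<close>

theorem graded_submodule_finitely_generated:
  fixes N :: "('n::finite, 'k::field) fvec set"
  assumes "graded_submodule d N"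
  shows "\<exists>G. finite G \<and> G \<subseteq> (\<Union>t. N \<inter> homog d t) \<and> fmod.span G = N"
proof -
  obtain h :: "'n \<Rightarrow> nat" where h: "inj h"
    using finite_imp_inj_to_nat_seg[of "UNIV :: 'n set"] by auto
  let ?key = "mon_key h"
  define leads where "leads f x \<longleftrightarrow> x \<in> monoms f \<and> (\<forall>y\<in>monoms f. ?key y \<le> ?key x)"
    for f :: "('n, 'k) fvec" and x
  define L where "L j = {u. \<exists>f \<in> (\<Union>t. N \<inter> homog d t). leads f (j, u)}" for j
  obtain B where B: "\<And>j. B j \<subseteq> L j" "\<And>j. finite (B j)"
      "\<And>j u. u \<in> L j \<Longrightarrow> \<exists>v\<in>B j. \<exists>w. u = w + v"
    using dickson[of "L _"] by metis
  have "\<forall>j v. \<exists>g. v \<in> B j \<longrightarrow> g \<in> (\<Union>t. N \<inter> homog d t) \<and> leads g (j, v)"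
    using B(1) unfolding L_def by blast
  then obtain g where g: "\<And>j v. v \<in> B j \<Longrightarrow> g j v \<in> (\<Union>t. N \<inter> homog d t)"
      "\<And>j v. v \<in> B j \<Longrightarrow> leads (g j v) (j, v)"
    by metis
  define G where "G = (\<Union>j<length d. g j ` B j)"
  have G: "finite G" "G \<subseteq> (\<Union>t. N \<inter> homog d t)"
    using B(2) g(1) by (auto simp: G_def)
  have sub: "fmod.subspace N" using assms by (rule subspace_graded)
  have reduce: "f \<in> fmod.span G" if "f \<in> N" "f \<in> homog d t" for f t
  proof -
    define X where "X = {(j, u :: 'n \<Rightarrow>\<^sub>0 nat). j < length d \<and> mon_deg d (j, u) = t}"
    have finX: "finite X" unfolding X_def by (rule finite_monomials_of_degree)
    define below where "below f = {x \<in> X. \<exists>y\<in>monoms f. ?key x \<le> ?key y}"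
      for f :: "('n, 'k) fvec"
    show ?thesis using that
    proof (induction "card (below f)" arbitrary: f rule: less_induct)
      case less
      show ?case
      proof (cases "f = 0")
        case True
        then show ?thesis by (simp add: fmod.span_zero)
      next
        case False
        then have ne: "monoms f \<noteq> {}" by simp
        have "Max (?key ` monoms f) \<in> ?key ` monoms f"
          using ne finite_monoms[of f] by simp
        then obtain x where x: "x \<in> monoms f" "?key x = Max (?key ` monoms f)" by auto
        obtain j u where ju: "x = (j, u)" by fastforce
        have lead: "leads f (j, u)"
          unfolding leads_def using x ju finite_monoms[of f] by simp
        have fX: "monoms f \<subseteq> X" using less.prems(2) by (auto simp: homog_iff X_def)
        then have j: "j < length d" "mon_deg d (j, u) = t" using x ju by (auto simp: X_def)
        have "u \<in> L j" using lead less.prems by (auto simp: L_def)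
        then obtain v w where v: "v \<in> B j" "u = w + v" using B(3) by blast
        let ?g = "g j v"
        define a where "a = Poly_Mapping.lookup (Poly_Mapping.lookup ?g j) v"
        define b where "b = Poly_Mapping.lookup (Poly_Mapping.lookup f j) u"
        define q where "q = fscale (Poly_Mapping.single w (b / a)) ?g"
        have lg: "leads ?g (j, v)" using g(2)[OF v(1)] .
        then have "a \<noteq> 0" by (simp add: leads_def mem_monoms a_def)
        obtain s where s: "?g \<in> N" "?g \<in> homog d s" using g(1)[OF v(1)] by blast
        have "mon_deg d (j, v) = s" using lg s(2) by (auto simp: leads_def homog_iff)
        then have "t = int (exp_deg w) + s" using j(2) v(2) by (simp add: mon_deg_shift)
        then have q: "q \<in> homog d t" unfolding q_def using homog_fscale_single[OF s(2)] by simp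
        have qN: "q \<in> N" unfolding q_def using sub s(1) by (rule fmod.subspace_scale)
        have qG: "q \<in> fmod.span G" unfolding q_def G_def
          using v(1) j(1) by (intro fmod.span_scale fmod.span_base) auto
        have coeff: "Poly_Mapping.lookup (Poly_Mapping.lookup q j) u = b"
          using \<open>a \<noteq> 0\<close> by (simp add: q_def v(2) lookup_fscale_single flip: a_def)
        have qle: "?key y \<le> ?key (j, u)" if "y \<in> monoms q" for y
        proof -
          obtain i z where "y = (i, w + z)" "(i, z) \<in> monoms ?g"
            using \<open>y \<in> monoms q\<close> monoms_fscale_single[of w "b / a" ?g] unfolding q_def by auto
          then show ?thesis using lg v(2) by (auto simp: leads_def mon_key_shift)
        qed
        have lt: "?key y < ?key (j, u)" if y: "y \<in> monoms (f - q)" for y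
        proof -
          have "?key y \<le> ?key (j, u)"
            using y monoms_diff[of f q] qle lead unfolding leads_def by blast
          moreover have "y \<noteq> (j, u)"
            using y coeff by (auto simp: mem_monoms lookup_minus b_def)
          ultimately show ?thesis using inj_mon_key[OF h] by (simp add: order_less_le inj_eq)
        qed
        have "below (f - q) \<subset> below f"
        proof (rule psubsetI)
          have "?key z \<le> ?key (j, u)" if "y \<in> monoms (f - q)" "?key z \<le> ?key y" for y z
            using lt[OF that(1)] that(2) by (rule order_trans[OF _ less_imp_le, rotated])
          then show "below (f - q) \<subseteq> below f"
            using x(1) ju unfolding below_def by blast
          have "(j, u) \<in> monoms f" using lead by (simp add: leads_def)
          then have "(j, u) \<in> below f" using fX by (auto simp: below_def)
          moreover have "(j, u) \<notin> below (f - q)" using lt leD unfolding below_def by blast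
          ultimately show "below (f - q) \<noteq> below f" by blast
        qed
        then have "card (below (f - q)) < card (below f)"
          by (intro psubset_card_mono) (simp_all add: below_def finX)
        then have "f - q \<in> fmod.span G"
          using less.hyps less.prems q qN sub
          by (simp add: homog_diff fmod.subspace_diff)
        then show ?thesis using fmod.span_add[OF _ qG] by fastforce
      qed
    qed
  qed
  have "N \<subseteq> fmod.span G"
    by (rule graded_submodule_subset_if_homog[OF assms]) (auto intro: reduce)
  moreover have "fmod.span G \<subseteq> N"
    using G(2) sub by (intro fmod.span_minimal) auto
  ultimately show ?thesis using G by blast
qed

lemma finite_subset_spanning:
  assumes "finite G" "fmod.span G = fmod.span B"
  shows "\<exists>B'\<subseteq>B. finite B' \<and> fmod.span B' = fmod.span B"
proof -
  have "\<exists>B'\<subseteq>B. finite B' \<and> g \<in> fmod.span B'" if "g \<in> G" for g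
  proof -
    have "g \<in> fmod.span B" using that assms(2) fmod.span_base by blast
    then obtain T r where T: "finite T" "T \<subseteq> B" "g = (\<Sum>x\<in>T. fscale (r x) x)"
      unfolding fmod.span_explicit by blast
    then have "g \<in> fmod.span T"
      by (simp add: fmod.span_sum fmod.span_scale fmod.span_base)
    then show ?thesis using T by blast
  qed
  then obtain T where T: "\<And>g. g \<in> G \<Longrightarrow> T g \<subseteq> B \<and> finite (T g) \<and> g \<in> fmod.span (T g)" by metis
  let ?B = "\<Union>g\<in>G. T g"
  have "G \<subseteq> fmod.span ?B"
    using T fmod.span_mono[of "T _" ?B] by blast
  then have "fmod.span G \<subseteq> fmod.span ?B" by (intro fmod.span_minimal) auto
  moreover have "fmod.span ?B \<subseteq> fmod.span B" using T by (intro fmod.span_mono) blast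
  ultimately have "fmod.span ?B = fmod.span B" using assms(2) by simp
  moreover have "finite ?B" "?B \<subseteq> B" using T assms(1) by auto
  ultimately show ?thesis by (intro exI[of _ ?B] conjI)
qed

text \<open>An irredundant generating set is obtained from a generating set with the fewest elements.\<close>

lemma irredundant_subset_spanning:
  assumes "graded_submodule d (fmod.span B)"
  shows "\<exists>G\<subseteq>B. finite G \<and> fmod.span G = fmod.span B \<and> (\<forall>H. H \<subset> G \<longrightarrow> fmod.span H \<noteq> fmod.span B)"
proof -
  let ?P = "\<lambda>G. G \<subseteq> B \<and> finite G \<and> fmod.span G = fmod.span B"
  obtain G0 where "?P G0"
    using graded_submodule_finitely_generated[OF assms] finite_subset_spanning by metis
  then obtain G where G: "?P G" and least: "\<And>H. ?P H \<Longrightarrow> card G \<le> card H"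
    using ex_has_least_nat[of ?P G0 card] by blast
  have "fmod.span H \<noteq> fmod.span B" if H: "H \<subset> G" for H
  proof
    assume "fmod.span H = fmod.span B"
    then have "?P H" using H G finite_subset[of H G] by auto
    then show False using least[of H] psubset_card_mono[of G H] G H by auto
  qed
  then show ?thesis using G by blast
qed

section \<open>Minimal graded free resolutions\<close>

text \<open>
  A list, because its positions index the basis of the free module that is mapped onto \<open>N\<close>;
  \<open>e\<close> records the degrees of that basis.
\<close>

definition minimal_generator_list ::
    "int list \<Rightarrow> ('n::finite, 'k::field) fvec set \<Rightarrow> int list \<Rightarrow> ('n, 'k) fvec list \<Rightarrow> bool" where
  "minimal_generator_list d N e gs \<longleftrightarrow>
     length e = length gs \<and> distinct gs \<and> (\<forall>i<length gs. gs ! i \<in> homog d (e ! i)) \<and>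
     fmod.span (set gs) = N \<and> (\<forall>H. H \<subset> set gs \<longrightarrow> fmod.span H \<noteq> N)"

abbreviation syzygies :: "int list \<Rightarrow> ('n::finite, 'k::field) fvec list \<Rightarrow> ('n, 'k) fvec set" where
  "syzygies e gs \<equiv> {x \<in> free_mod e. lincomb gs x = 0}"

lemma mon_deg_lincomb:
  assumes "\<forall>i<length gs. gs ! i \<in> homog d (e ! i)" "i < length gs" "(j, v) \<in> monoms (gs ! i)"
  shows "mon_deg d (j, u + v) = mon_deg e (i, u)"
  using assms by (fastforce simp: homog_iff mon_deg_shift mon_deg.simps[of e])

lemma homog_lincomb:
  assumes gs: "\<forall>i<length gs. gs ! i \<in> homog d (e ! i)" and x: "x \<in> homog e t"
  shows "lincomb gs x \<in> homog d t"
proof -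
  have "monoms (lincomb gs x) \<subseteq> {(j, u). j < length d \<and> mon_deg d (j, u) = t}"
  proof (rule monoms_lincomb)
    fix i u j v assume *: "(i, u) \<in> monoms x" "i < length gs" "(j, v) \<in> monoms (gs ! i)"
    then have "mon_deg d (j, u + v) = t"
      using mon_deg_lincomb[OF gs] x by (auto simp: homog_iff)
    moreover have "j < length d" using gs * by (auto simp: homog_iff)
    ultimately show "(j, u + v) \<in> {(j, u). j < length d \<and> mon_deg d (j, u) = t}" by simp
  qed
  then show ?thesis by (auto simp: homog_iff)
qed

lemma graded_submodule_syzygies:
  assumes "\<forall>i<length gs. gs ! i \<in> homog d (e ! i)"
  shows "graded_submodule e (syzygies e gs)"
proof -
  have "fmod.subspace (syzygies e gs)"
    using fmod.subspace_inter[OF subspace_free_mod module_hom.subspace_kernel[OF module_hom_lincomb]]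
    by (simp add: Int_def)
  moreover have "lincomb gs (terms_where (\<lambda>x. mon_deg e x = t) x) =
      terms_where (\<lambda>x. mon_deg d x = t) (lincomb gs x)" for t x
    by (rule terms_where_lincomb[symmetric]) (simp add: mon_deg_lincomb[OF assms])
  ultimately show ?thesis
    by (auto simp: graded_submodule_def intro: terms_where_free_mod)
qed

lemma free_mod_decompose:
  assumes "x \<in> free_mod e"
  shows "x = (\<Sum>i<length e. fscale (Poly_Mapping.lookup x i) (Poly_Mapping.single i 1))"
proof (rule poly_mapping_eqI)
  fix k
  have "Poly_Mapping.lookup (\<Sum>i<length e. fscale (Poly_Mapping.lookup x i) (Poly_Mapping.single i 1)) k =
      (\<Sum>i<length e. if i = k then Poly_Mapping.lookup x k else 0)"
    unfolding lookup_sum by (intro sum.cong refl) (simp add: lookup_fscale lookup_single when_def)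
  also have "\<dots> = Poly_Mapping.lookup x k"
    using assms by (auto simp: free_mod_def subset_iff in_keys_iff)
  finally show "Poly_Mapping.lookup x k =
      Poly_Mapping.lookup (\<Sum>i<length e. fscale (Poly_Mapping.lookup x i) (Poly_Mapping.single i 1)) k"
    by simp
qed

lemma unit_vector_homog: "i < length e \<Longrightarrow> Poly_Mapping.single i 1 \<in> homog e (e ! i)"
  using monoms_fterm[of i 0 1] by (auto simp: homog_iff mon_deg.simps)

lemma homog_subset_free_mod: "homog d t \<subseteq> free_mod d"
  by (auto simp: homog_def)

lemma exp_deg_eq_0: "exp_deg u = 0 \<longleftrightarrow> u = 0"
proof
  assume "exp_deg u = 0"
  then have "Poly_Mapping.lookup u i = 0" for i by simp
  then show "u = 0" by (intro poly_mapping_eqI) simp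
qed simp

text \<open>
  If a syzygy of homogeneous generators had a coefficient with nonzero constant term, then its
  part in the degree of that generator would express the generator through the others.
\<close>

lemma syzygies_minimal:
  fixes N :: "('n::finite, 'k::field) fvec set"
  assumes "minimal_generator_list d N e gs"
  shows "syzygies e gs \<subseteq> irrelevant_mult (free_mod e)"
proof
  fix x assume x: "x \<in> syzygies e gs"
  have len: "length e = length gs" and dist: "distinct gs"
    and hom: "\<forall>i<length gs. gs ! i \<in> homog d (e ! i)"
    and span: "fmod.span (set gs) = N" and irr: "\<And>H. H \<subset> set gs \<Longrightarrow> fmod.span H \<noteq> N"
    using assms by (auto simp: minimal_generator_list_def)
  have const: "Poly_Mapping.lookup (Poly_Mapping.lookup x i) 0 = 0" if i: "i < length e" for i
  proof (rule ccontr)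
    define c where "c = Poly_Mapping.lookup (Poly_Mapping.lookup x i) 0"
    assume "Poly_Mapping.lookup (Poly_Mapping.lookup x i) 0 \<noteq> 0"
    then have c: "c \<noteq> 0" by (simp add: c_def)
    define y where "y = terms_where (\<lambda>m. mon_deg e m = e ! i) x"
    have "lincomb gs y = terms_where (\<lambda>m. mon_deg d m = e ! i) (lincomb gs x)"
      unfolding y_def by (rule terms_where_lincomb[symmetric]) (simp add: mon_deg_lincomb[OF hom])
    then have zero: "lincomb gs y = 0" using x by simp
    have yi: "Poly_Mapping.lookup y i = Poly_Mapping.single 0 c"
    proof (rule poly_mapping_eqI)
      fix u :: "'n \<Rightarrow>\<^sub>0 nat"
      have "mon_deg e (i, u) = e ! i \<longleftrightarrow> u = 0"
        using exp_deg_eq_0[of u] by (simp add: mon_deg.simps del: of_nat_sum sum_eq_0_iff)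
      then show "Poly_Mapping.lookup (Poly_Mapping.lookup y i) u =
          Poly_Mapping.lookup (Poly_Mapping.single 0 c) u"
        by (auto simp: y_def lookup_terms_where c_def lookup_single when_def)
    qed
    let ?H = "set gs - {gs ! i}"
    have "lincomb gs y = fscale (Poly_Mapping.single 0 c) (gs ! i) +
        (\<Sum>k\<in>{..<length gs} - {i}. fscale (Poly_Mapping.lookup y k) (gs ! k))"
      unfolding lincomb_def using i len by (subst sum.remove[of _ i]) (auto simp: yi)
    then have "fscale (Poly_Mapping.single 0 c) (gs ! i) =
        - (\<Sum>k\<in>{..<length gs} - {i}. fscale (Poly_Mapping.lookup y k) (gs ! k))"
      using zero by (simp add: eq_neg_iff_add_eq_0)
    moreover have "(\<Sum>k\<in>{..<length gs} - {i}. fscale (Poly_Mapping.lookup y k) (gs ! k))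
        \<in> fmod.span ?H"
      using dist i len
      by (intro fmod.span_sum fmod.span_scale fmod.span_base) (auto simp: nth_eq_iff_index_eq)
    ultimately have "fscale (Poly_Mapping.single 0 c) (gs ! i) \<in> fmod.span ?H"
      by (simp add: fmod.span_neg)
    then have "fscale (Poly_Mapping.single 0 (1 / c)) (fscale (Poly_Mapping.single 0 c) (gs ! i))
        \<in> fmod.span ?H"
      by (rule fmod.span_scale)
    then have "gs ! i \<in> fmod.span ?H" using c by (simp add: mult_single)
    then have "set gs \<subseteq> fmod.span ?H" using fmod.span_superset[of ?H] by blast
    then have "fmod.span ?H = N"
      unfolding span[symmetric]
      by (intro antisym fmod.span_mono fmod.span_minimal) auto
    moreover have "gs ! i \<in> set gs" using i len by simp
    then have "?H \<subset> set gs" by blast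
    ultimately show False using irr[of ?H] by simp
  qed
  have "(\<Sum>i<length e. fscale (Poly_Mapping.lookup x i) (Poly_Mapping.single i 1))
      \<in> irrelevant_mult (free_mod e)"
    unfolding irrelevant_mult_def
  proof (intro fmod.span_sum fmod.span_base CollectI exI conjI)
    fix i assume "i \<in> {..<length e}"
    then have i: "i < length e" by simp
    then show "Poly_Mapping.lookup x i \<in> irrelevant_ideal"
      using const by (simp add: irrelevant_ideal_def)
    show "(Poly_Mapping.single i 1 :: ('n, 'k) fvec) \<in> free_mod e"
      by (rule subsetD[OF homog_subset_free_mod unit_vector_homog[OF i]])
  qed (rule refl)
  then show "x \<in> irrelevant_mult (free_mod e)"
    using free_mod_decompose[of x e] x by auto
qed

lemma minimal_generator_list_exists_from:
  assumes "B \<subseteq> homog d b"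
  shows "\<exists>gs. set gs \<subseteq> B \<and> minimal_generator_list d (fmod.span B) (replicate (length gs) b) gs"
proof -
  have "graded_submodule d (fmod.span B)"
    using assms by (intro graded_submodule_span) blast
  then obtain G where G: "G \<subseteq> B" "finite G" "fmod.span G = fmod.span B"
      "\<And>H. H \<subset> G \<Longrightarrow> fmod.span H \<noteq> fmod.span B"
    using irredundant_subset_spanning by metis
  obtain gs where gs: "set gs = G" "distinct gs"
    using finite_distinct_list[OF G(2)] by blast
  have "\<forall>i<length gs. gs ! i \<in> homog d b" using G(1) gs(1) assms nth_mem by blast
  then have "minimal_generator_list d (fmod.span B) (replicate (length gs) b) gs"
    unfolding minimal_generator_list_def using G gs by auto
  then show ?thesis using gs G by blast
qed

lemma minimal_generator_list_exists:
  assumes "graded_submodule d N"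
  shows "\<exists>e gs. minimal_generator_list d N e gs"
proof -
  have "fmod.span (\<Union>t. N \<inter> homog d t) = N"
  proof
    show "fmod.span (\<Union>t. N \<inter> homog d t) \<subseteq> N"
      using subspace_graded[OF assms] by (intro fmod.span_minimal) auto
    show "N \<subseteq> fmod.span (\<Union>t. N \<inter> homog d t)"
      by (rule graded_submodule_subset_if_homog[OF assms]) (auto intro: fmod.span_base)
  qed
  then obtain G where G: "G \<subseteq> (\<Union>t. N \<inter> homog d t)" "finite G" "fmod.span G = N"
      "\<And>H. H \<subset> G \<Longrightarrow> fmod.span H \<noteq> N"
    using irredundant_subset_spanning[of d "\<Union>t. N \<inter> homog d t"] assms by metis
  obtain gs where gs: "set gs = G" "distinct gs"
    using finite_distinct_list[OF G(2)] by blast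
  obtain \<delta> where \<delta>: "\<And>g. g \<in> G \<Longrightarrow> g \<in> homog d (\<delta> g)"
    using G(1) by (metis (no_types, lifting) IntD2 UN_E subset_iff)
  have "minimal_generator_list d N (map \<delta> gs) gs"
    unfolding minimal_generator_list_def using G gs \<delta> nth_mem[of _ gs] by auto
  then show ?thesis by blast
qed

text \<open>
  Any choice of minimal generators starts a minimal resolution, since the syzygies at each step
  are again a graded submodule of a free module and so have finitely many minimal
  generators. The freedom in the first step is essential: it is applied to generators that
  are initial forms.
\<close>

lemma minimal_resolution_extends_generators:
  assumes "minimal_generator_list d N e gs"
  shows "\<exists>D \<phi>. minimal_graded_free_resolution d N D \<phi> \<and> D 0 = e \<and> \<phi> 0 = lincomb gs"
proof -
  let ?P = "\<lambda>n x. (\<exists>d N. minimal_generator_list d N (fst x) (snd x)) \<and> (n = (0::nat) \<longrightarrow> x = (e, gs))"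
  let ?Q = "\<lambda>(n::nat) x y.
    minimal_generator_list (fst x) (syzygies (fst x) (snd x)) (fst y) (snd y)"
  have "\<exists>F. \<forall>n. ?P n (F n) \<and> ?Q n (F n) (F (Suc n))"
  proof (rule dependent_nat_choice)
    show "\<exists>x. ?P 0 x" using assms by auto
  next
    fix x n assume "?P n x"
    then obtain d N where "minimal_generator_list d N (fst x) (snd x)" by blast
    then have "graded_submodule (fst x) (syzygies (fst x) (snd x))"
      unfolding minimal_generator_list_def using graded_submodule_syzygies by blast
    then obtain e' gs' where "minimal_generator_list (fst x) (syzygies (fst x) (snd x)) e' gs'"
      using minimal_generator_list_exists by blast
    then show "\<exists>y. ?P (Suc n) y \<and> ?Q n x y" by (intro exI[of _ "(e', gs')"]) auto
  qed
  then obtain F where F: "\<And>n. ?P n (F n)" "\<And>n. ?Q n (F n) (F (Suc n))" by blast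
  define D where "D n = fst (F n)" for n
  define \<phi> where "\<phi> n = lincomb (snd (F n))" for n
  have F0: "F 0 = (e, gs)" using F(1)[of 0] by simp
  have image: "lincomb gs ` free_mod e = N"
    if "minimal_generator_list d N e gs" for d e gs and N :: "('a, 'b) fvec set"
    using that lincomb_image[of e gs] by (simp add: minimal_generator_list_def)
  have hom: "lincomb gs ` homog e t \<subseteq> homog d t"
    if "minimal_generator_list d N e gs" for d e gs t and N :: "('a, 'b) fvec set"
    using that homog_lincomb[of gs d e] by (auto simp: minimal_generator_list_def)
  have "minimal_graded_free_resolution d N D \<phi>"
    unfolding minimal_graded_free_resolution_def
  proof (intro conjI allI)
    fix i t
    show "module_hom fscale fscale (\<phi> i)" unfolding \<phi>_def by (rule module_hom_lincomb)
    show "\<phi> 0 ` homog (D 0) t \<subseteq> homog d t"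
      using hom[OF assms] by (simp add: D_def \<phi>_def F0)
    show "\<phi> (Suc i) ` homog (D (Suc i)) t \<subseteq> homog (D i) t"
      using hom[OF F(2)] by (simp add: D_def \<phi>_def)
    show "\<phi> 0 ` free_mod (D 0) = N"
      using image[OF assms] by (simp add: D_def \<phi>_def F0)
    show im: "\<phi> (Suc i) ` free_mod (D (Suc i)) = {x \<in> free_mod (D i). \<phi> i x = 0}"
      using image[OF F(2)] by (simp add: D_def \<phi>_def)
    obtain d' N' where "minimal_generator_list d' N' (fst (F i)) (snd (F i))" using F(1) by blast
    from syzygies_minimal[OF this]
    show "\<phi> (Suc i) ` free_mod (D (Suc i)) \<subseteq> irrelevant_mult (free_mod (D i))"
      unfolding im by (simp add: D_def \<phi>_def)
  qed
  then show ?thesis using F0 by (intro exI[of _ D] exI[of _ \<phi>]) (simp add: D_def \<phi>_def)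
qed

lemma betti_le_regularity:
  assumes "minimal_graded_free_resolution d N D \<phi>" "j \<in> set (D i)"
    and "regularity d N \<le> ereal (of_int r)"
  shows "j - int i \<le> r"
proof -
  have "betti_nonzero d N i j" using assms by (auto simp: betti_nonzero_def)
  then have "ereal (of_int (j - int i)) \<le> regularity d N"
    unfolding regularity_def by (intro Sup_upper) blast
  then have "ereal (of_int (j - int i)) \<le> ereal (of_int r)" using assms(3) by (rule order_trans)
  then show ?thesis by simp
qed

lemma generator_degree_le_regularity:
  assumes "minimal_generator_list d N e gs" "regularity d N \<le> ereal (of_int r)" "t \<in> set e"
  shows "t \<le> r"
  using minimal_resolution_extends_generators[OF assms(1)] betti_le_regularity[of d N _ _ t 0 r] assms
  by auto

text \<open>
  The first syzygies are the image of the second free module of a resolution that starts with the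
  given generators, and regularity \<open>r\<close> bounds the degrees of its basis by \<open>r + 1\<close>.
\<close>

lemma syzygies_generated_by_regularity:
  assumes "minimal_generator_list d N e gs" "regularity d N \<le> ereal (of_int r)"
  shows "syzygies e gs \<subseteq> fmod.span (\<Union>t\<in>{..r + 1}. syzygies e gs \<inter> homog e t)"
proof -
  obtain D \<phi> where res: "minimal_graded_free_resolution d N D \<phi>" and D0: "D 0 = e"
      and \<phi>0: "\<phi> 0 = lincomb gs"
    using minimal_resolution_extends_generators[OF assms(1)] by blast
  have hom: "module_hom fscale fscale (\<phi> 1)"
    and deg: "\<phi> 1 ` homog (D 1) t \<subseteq> homog (D 0) t"
    and im: "\<phi> 1 ` free_mod (D 1) = {x \<in> free_mod (D 0). \<phi> 0 x = 0}" for t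
    using res unfolding minimal_graded_free_resolution_def One_nat_def by simp_all
  note deg = deg[unfolded D0] and im = im[unfolded D0 \<phi>0]
  let ?S = "fmod.span (\<Union>t\<in>{..r + 1}. syzygies e gs \<inter> homog e t)"
  have gen: "\<phi> 1 (Poly_Mapping.single k 1) \<in> ?S" if k: "k < length (D 1)" for k
  proof -
    have "D 1 ! k - int 1 \<le> r"
      using k by (intro betti_le_regularity[OF res _ assms(2)]) simp
    moreover have "\<phi> 1 (Poly_Mapping.single k 1) \<in> homog e (D 1 ! k)"
      using deg unit_vector_homog[OF k] by blast
    moreover have "\<phi> 1 (Poly_Mapping.single k 1) \<in> syzygies e gs"
      unfolding im[symmetric] using unit_vector_homog[OF k] homog_subset_free_mod by blast
    ultimately show ?thesis by (intro fmod.span_base UN_I[of "D 1 ! k"]) auto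
  qed
  have "\<phi> 1 y \<in> ?S" if "y \<in> free_mod (D 1)" for y
  proof -
    have "\<phi> 1 (\<Sum>i<length (D 1). fscale (Poly_Mapping.lookup y i) (Poly_Mapping.single i 1)) \<in> ?S"
      unfolding module_hom.sum[OF hom] module_hom.scale[OF hom]
      by (intro fmod.span_sum fmod.span_scale gen) simp
    then show ?thesis using free_mod_decompose[OF that] by simp
  qed
  then show ?thesis unfolding im[symmetric] by blast
qed

section \<open>Degrees of generators\<close>

lemma minimal_generators_exist:
  assumes "graded_submodule d N"
  shows "\<exists>G. minimal_generators d N G"
proof -
  obtain e gs where gs: "minimal_generator_list d N e gs"
    using minimal_generator_list_exists[OF assms] by blast
  have "set gs \<subseteq> (\<Union>t. homog d t)"
  proof
    fix g assume "g \<in> set gs"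
    then obtain i where "i < length gs" "g = gs ! i" by (auto simp: in_set_conv_nth)
    then have "g \<in> homog d (e ! i)" using gs by (simp add: minimal_generator_list_def)
    then show "g \<in> (\<Union>t. homog d t)" by blast
  qed
  then have "minimal_generators d N (set gs)"
    using gs by (simp add: minimal_generator_list_def minimal_generators_def)
  then show ?thesis by blast
qed

text \<open>
  With respect to a minimal generating set that avoids degree \<open>t\<close>, the degree \<open>t\<close> part of an element
  only sees the generators of lower degree, because multiples of the others start above \<open>t\<close>.
\<close>

lemma component_generated_below_if_no_minimal_generator:
  assumes N: "graded_submodule d N" and none: "\<not> has_minimal_generator_in_degree d N t"
  shows "N \<inter> homog d t \<subseteq> fmod.span (\<Union>s\<in>{..<t}. N \<inter> homog d s)"
proof
  let ?U = "fmod.span (\<Union>s\<in>{..<t}. N \<inter> homog d s)"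
  have U: "graded_submodule d ?U" by (rule graded_submodule_span) blast
  obtain G where G: "G \<subseteq> (\<Union>t. homog d t)" "fmod.span G = N" "G \<inter> homog d t = {}"
    using minimal_generators_exist[OF N] none
    unfolding has_minimal_generator_in_degree_def minimal_generators_def by blast
  let ?part = "terms_where (\<lambda>x. mon_deg d x = t)"
  have gen: "?part (fscale p g) \<in> ?U" if g: "g \<in> G" for p g
  proof -
    obtain s where s: "g \<in> homog d s" using G(1) g by blast
    then have "s \<noteq> t" using G(3) g by blast
    then consider "s < t" | "t < s" by linarith
    then show ?thesis
    proof cases
      case 1
      then have "g \<in> ?U" using s g G(2) fmod.span_base[of g G] by (intro fmod.span_base) blast
      then have "fscale p g \<in> ?U" by (rule fmod.span_scale)
      then show ?thesis using graded_submodule_homog_part[OF U] by blast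
    next
      case 2
      have "?part (fscale p g) = 0"
      proof (induction p rule: mpol_induct)
        case (single u c)
        have "fscale (Poly_Mapping.single u c) g \<in> homog d (int (exp_deg u) + s)"
          using s by (rule homog_fscale_single)
        then show ?case
          using 2 by (intro terms_where_none) (auto simp: homog_iff simp del: of_nat_sum)
      qed (simp_all add: fmod.scale_left_distrib terms_where_add)
      then show ?thesis by (simp only: fmod.span_zero)
    qed
  qed
  fix f assume f: "f \<in> N \<inter> homog d t"
  then have "f \<in> fmod.span G" using G(2) by simp
  then have "?part f \<in> ?U"
  proof (induction rule: fmod.span_induct_alt)
    case base
    show ?case by (simp only: terms_where_zero fmod.span_zero)
  next
    case (step p g h)
    then show ?case unfolding terms_where_add by (intro fmod.span_add gen)
  qed
  then show "f \<in> ?U" using f by (simp add: homog_part_self)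
qed

lemma component_generated_in_lower_degrees:
  assumes N: "graded_submodule d N"
    and none: "\<And>t. a < t \<Longrightarrow> t \<le> b \<Longrightarrow> \<not> has_minimal_generator_in_degree d N t"
    and "t \<le> b"
  shows "N \<inter> homog d t \<subseteq> fmod.span (\<Union>s\<in>{..a}. N \<inter> homog d s)"
  using \<open>t \<le> b\<close>
proof (induction "nat (t - a)" arbitrary: t rule: less_induct)
  case less
  let ?S = "fmod.span (\<Union>s\<in>{..a}. N \<inter> homog d s)"
  have le: "N \<inter> homog d s \<subseteq> ?S" if "s \<le> a" for s
    using that by (auto intro: fmod.span_base)
  show ?case
  proof (cases "t \<le> a")
    case False
    have "N \<inter> homog d s \<subseteq> ?S" if "s < t" for s
      using le[of s] less.hyps[of s] that False less.prems by (cases "s \<le> a") auto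
    then have "(\<Union>s\<in>{..<t}. N \<inter> homog d s) \<subseteq> ?S" by blast
    then have "fmod.span (\<Union>s\<in>{..<t}. N \<inter> homog d s) \<subseteq> ?S"
      by (rule fmod.span_minimal) simp
    then show ?thesis
      using component_generated_below_if_no_minimal_generator[OF N none[of t]] False less.prems
      by auto
  qed (use le in blast)
qed

lemma exponent_split:
  fixes v :: "'n::finite \<Rightarrow>\<^sub>0 nat"
  assumes "k \<le> exp_deg v"
  shows "\<exists>v1 v2. v = v1 + v2 \<and> exp_deg v2 = k"
  using assms
proof (induction k)
  case 0
  show ?case by (intro exI[of _ v] exI[of _ 0]) simp
next
  case (Suc k)
  then obtain v1 v2 where v: "v = v1 + v2" "exp_deg v2 = k" by auto
  then have "exp_deg v1 \<noteq> 0" using Suc.prems by (simp add: exp_deg_add del: sum_eq_0_iff)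
  then obtain i where i: "Poly_Mapping.lookup v1 i \<noteq> 0" by auto
  define x where "x = (Poly_Mapping.single i 1 :: 'n \<Rightarrow>\<^sub>0 nat)"
  have "v1 = (v1 - x) + x"
    using i by (intro poly_mapping_eqI) (auto simp: x_def lookup_add lookup_minus lookup_single when_def)
  then have "v = (v1 - x) + (x + v2)" using v(1) by (metis add.assoc)
  moreover have "exp_deg x = 1" by (simp add: x_def lookup_single when_def)
  then have "exp_deg (x + v2) = Suc k" using v(2) by (simp add: exp_deg_add)
  ultimately show ?case by blast
qed

text \<open>
  Above degree \<open>a\<close>, a module generated in degrees at most \<open>a\<close> is generated by its component of
  degree \<open>a\<close>: a monomial that moves a lower generator beyond degree \<open>a\<close> factors through degree \<open>a\<close>.
\<close>

lemma truncation_generated_by_component: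
  fixes N :: "('n::finite, 'k::field) fvec set"
  assumes N: "graded_submodule d N"
    and f: "f \<in> fmod.span (\<Union>s\<in>{..a}. N \<inter> homog d s)" "f \<in> homog d t" and t: "a \<le> t"
  shows "f \<in> fmod.span (N \<inter> homog d a)"
proof -
  have sub: "fmod.subspace N" using N by (rule subspace_graded)
  let ?part = "\<lambda>t. terms_where (\<lambda>x. mon_deg d x = t)"
  let ?C = "fmod.span (N \<inter> homog d a)"
  let ?U = "{f \<in> N. \<forall>t\<ge>a. ?part t f \<in> ?C}"
  have "fmod.subspace ?U"
  proof (rule subspaceI_monomials)
    fix v c and f :: "('n, 'k) fvec" assume f: "f \<in> ?U"
    let ?X = "fscale (Poly_Mapping.single v c) :: ('n, 'k) fvec \<Rightarrow> _"
    have "?part t (?X f) \<in> ?C" if t: "a \<le> t" for t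
    proof -
      define s where "s = t - int (exp_deg v)"
      have part: "?part t (?X f) = ?X (?part s f)"
        unfolding terms_where_fscale_single s_def
        by (rule arg_cong[where f = "fscale _"], rule terms_where_cong) (auto simp: mon_deg_shift)
      show ?thesis
      proof (cases "a \<le> s")
        case True
        then show ?thesis unfolding part using f by (simp add: fmod.span_scale)
      next
        case False
        have h: "?part s f \<in> N \<inter> homog d s"
          using graded_submodule_homog_part[OF N] f by blast
        have "nat (a - s) \<le> exp_deg v" using t by (simp add: s_def del: of_nat_sum)
        then obtain v1 v2 where v: "v = v1 + v2" "exp_deg v2 = nat (a - s)"
          using exponent_split by blast
        have "fscale (Poly_Mapping.single v2 1) (?part s f) \<in> homog d (int (exp_deg v2) + s)"
          using h by (intro homog_fscale_single) blast
        moreover have "int (exp_deg v2) + s = a" using v(2) False by (simp del: of_nat_sum)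
        ultimately have "fscale (Poly_Mapping.single v2 1) (?part s f) \<in> N \<inter> homog d a"
          using h fmod.subspace_scale[OF sub] by auto
        then have "fscale (Poly_Mapping.single v1 c) (fscale (Poly_Mapping.single v2 1) (?part s f)) \<in> ?C"
          by (intro fmod.span_scale fmod.span_base)
        then show ?thesis unfolding part by (simp add: mult_single v(1))
      qed
    qed
    then show "?X f \<in> ?U" using f fmod.subspace_scale[OF sub] by blast
  qed (use fmod.subspace_0[OF sub] fmod.subspace_add[OF sub] in
      \<open>auto simp: fmod.span_zero fmod.span_add terms_where_add\<close>)
  moreover have "N \<inter> homog d s \<subseteq> ?U" if "s \<le> a" for s
  proof
    fix g assume g: "g \<in> N \<inter> homog d s"
    have "?part t g \<in> ?C" if "a \<le> t" for t
    proof (cases "s = t")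
      case True
      then have "s = a" using \<open>s \<le> a\<close> that by simp
      then show ?thesis using g True by (simp add: homog_part_self fmod.span_base)
    next
      case False
      then have "?part t g = 0" using g by (intro terms_where_none) (auto simp: homog_iff)
      then show ?thesis by (simp only: fmod.span_zero)
    qed
    then show "g \<in> ?U" using g by blast
  qed
  then have "(\<Union>s\<in>{..a}. N \<inter> homog d s) \<subseteq> ?U" by blast
  ultimately have "f \<in> ?U" using f(1) fmod.span_minimal by blast
  then show ?thesis using t f(2) homog_part_self[OF f(2)] by auto
qed

section \<open>Initial forms\<close>

lemma initial_form_eqI:
  assumes "\<And>x. x \<in> monoms f \<Longrightarrow> mon_weight \<omega> \<epsilon> x \<le> W"
    and "x \<in> monoms f" "mon_weight \<omega> \<epsilon> x = W"
  shows "initial_form \<omega> \<epsilon> f = terms_where (\<lambda>x. mon_weight \<omega> \<epsilon> x = W) f"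
proof -
  have "Max (mon_weight \<omega> \<epsilon> ` monoms f) = W"
    using assms finite_monoms[of f] by (intro Max_eqI) auto
  then show ?thesis by (simp add: initial_form_def)
qed

lemma initial_formE:
  assumes "f \<noteq> 0"
  obtains W x where "\<And>x. x \<in> monoms f \<Longrightarrow> mon_weight \<omega> \<epsilon> x \<le> W"
    "x \<in> monoms f" "mon_weight \<omega> \<epsilon> x = W"
    "initial_form \<omega> \<epsilon> f = terms_where (\<lambda>x. mon_weight \<omega> \<epsilon> x = W) f"
proof -
  let ?W = "Max (mon_weight \<omega> \<epsilon> ` monoms f)"
  have "?W \<in> mon_weight \<omega> \<epsilon> ` monoms f"
    using assms finite_monoms[of f] by (intro Max_in) auto
  then obtain x where "x \<in> monoms f" "mon_weight \<omega> \<epsilon> x = ?W" by auto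
  moreover have "mon_weight \<omega> \<epsilon> x \<le> ?W" if "x \<in> monoms f" for x
    using that finite_monoms[of f] by simp
  ultimately show ?thesis using that[of ?W x] unfolding initial_form_def by blast
qed

lemma homog_initial_form: "f \<in> homog d t \<Longrightarrow> initial_form \<omega> \<epsilon> f \<in> homog d t"
  unfolding initial_form_def by (rule homog_terms_where)

lemma initial_form_fscale_monomial:
  assumes "f \<noteq> 0"
  shows "initial_form \<omega> \<epsilon> (fscale (Poly_Mapping.single v 1) f) =
    fscale (Poly_Mapping.single v 1) (initial_form \<omega> \<epsilon> f)"
    and "fscale (Poly_Mapping.single v 1) f \<noteq> 0"
proof -
  let ?X = "fscale (Poly_Mapping.single v 1)"
  let ?n = "\<Sum>i\<in>UNIV. \<omega> i * Poly_Mapping.lookup v i"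
  obtain W x where W: "\<And>x. x \<in> monoms f \<Longrightarrow> mon_weight \<omega> \<epsilon> x \<le> W"
    "x \<in> monoms f" "mon_weight \<omega> \<epsilon> x = W"
    "initial_form \<omega> \<epsilon> f = terms_where (\<lambda>x. mon_weight \<omega> \<epsilon> x = W) f"
    using initial_formE[OF assms] by metis
  obtain j u where x: "x = (j, u)" by fastforce
  have mem: "(j, v + u) \<in> monoms (?X f)"
    using W(2) by (simp add: mem_monoms lookup_fscale_single x)
  then show "?X f \<noteq> 0" by auto
  have "initial_form \<omega> \<epsilon> (?X f) = terms_where (\<lambda>x. mon_weight \<omega> \<epsilon> x = ?n + W) (?X f)"
  proof (rule initial_form_eqI[OF _ mem])
    show "mon_weight \<omega> \<epsilon> (j, v + u) = ?n + W" using W(3) x by (simp add: mon_weight_shift)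
    fix y assume "y \<in> monoms (?X f)"
    then obtain i z where "y = (i, v + z)" "(i, z) \<in> monoms f"
      using monoms_fscale_single[of v 1 f] by auto
    then show "mon_weight \<omega> \<epsilon> y \<le> ?n + W" using W(1) by (simp add: mon_weight_shift)
  qed
  also have "\<dots> = ?X (terms_where (\<lambda>x. mon_weight \<omega> \<epsilon> x = W) f)"
    unfolding terms_where_fscale_single
    by (rule arg_cong[where f = "fscale _"], rule terms_where_cong) (auto simp: mon_weight_shift)
  finally show "initial_form \<omega> \<epsilon> (?X f) = ?X (initial_form \<omega> \<epsilon> f)" using W(4) by simp
qed

definition initial_forms_in_degree ::
    "('n::finite \<Rightarrow> nat) \<Rightarrow> nat list \<Rightarrow> int list \<Rightarrow> ('n, 'k::field) fvec set \<Rightarrow> int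
      \<Rightarrow> ('n, 'k) fvec set" where
  "initial_forms_in_degree \<omega> \<epsilon> d M t = initial_form \<omega> \<epsilon> ` (M \<inter> homog d t - {0})"

lemma initial_forms_in_degree_homog: "initial_forms_in_degree \<omega> \<epsilon> d M t \<subseteq> homog d t"
  by (auto simp: initial_forms_in_degree_def homog_initial_form)

text \<open>
  The degree \<open>t\<close> part of an initial form is zero or the initial form of the degree \<open>t\<close> part,
  so homogeneous elements suffice.
\<close>

lemma initial_submodule_eq_span_homog:
  assumes M: "graded_submodule d M"
  shows "initial_submodule \<omega> \<epsilon> M = fmod.span (\<Union>t. initial_forms_in_degree \<omega> \<epsilon> d M t)"
    (is "_ = ?R")
proof
  show "?R \<subseteq> initial_submodule \<omega> \<epsilon> M"
    unfolding initial_submodule_def initial_forms_in_degree_def by (intro fmod.span_mono) blast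
  have "initial_form \<omega> \<epsilon> f \<in> ?R" if f: "f \<in> M" "f \<noteq> 0" for f
  proof -
    let ?part = "\<lambda>t. terms_where (\<lambda>x. mon_deg d x = t)"
    obtain W where W: "\<And>x. x \<in> monoms f \<Longrightarrow> mon_weight \<omega> \<epsilon> x \<le> W"
      "initial_form \<omega> \<epsilon> f = terms_where (\<lambda>x. mon_weight \<omega> \<epsilon> x = W) f"
      using initial_formE[OF f(2)] by metis
    have "?part t (initial_form \<omega> \<epsilon> f) \<in> ?R" for t
    proof (cases "?part t (initial_form \<omega> \<epsilon> f) = 0")
      case True
      then show ?thesis by (simp only: fmod.span_zero)
    next
      case False
      have eq: "?part t (initial_form \<omega> \<epsilon> f) = terms_where (\<lambda>x. mon_weight \<omega> \<epsilon> x = W) (?part t f)"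
        unfolding W(2) terms_where_terms_where by (simp add: conj_commute)
      then have "monoms (terms_where (\<lambda>x. mon_weight \<omega> \<epsilon> x = W) (?part t f)) \<noteq> {}"
        using False by simp
      then obtain x where x: "x \<in> monoms (?part t f)" "mon_weight \<omega> \<epsilon> x = W"
        by (auto simp: monoms_terms_where)
      have "initial_form \<omega> \<epsilon> (?part t f) = ?part t (initial_form \<omega> \<epsilon> f)"
        unfolding eq by (rule initial_form_eqI[OF _ x]) (auto simp: monoms_terms_where W(1))
      moreover have "?part t f \<in> M \<inter> homog d t" using graded_submodule_homog_part[OF M f(1)] .
      moreover have "?part t f \<noteq> 0" using x(1) by auto
      ultimately show ?thesis
        unfolding initial_forms_in_degree_def
        by (intro fmod.span_base UN_I[OF UNIV_I, of _ _ t] image_eqI[of _ _ "?part t f"]) auto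
    qed
    then have "(\<Sum>t\<in>mon_deg d ` monoms (initial_form \<omega> \<epsilon> f). ?part t (initial_form \<omega> \<epsilon> f)) \<in> ?R"
      by (intro fmod.span_sum)
    then show ?thesis by (simp only: sum_homog_parts)
  qed
  then show "initial_submodule \<omega> \<epsilon> M \<subseteq> ?R"
    unfolding initial_submodule_def by (intro fmod.span_minimal) auto
qed

lemma graded_submodule_initial_submodule:
  assumes "graded_submodule d M"
  shows "graded_submodule d (initial_submodule \<omega> \<epsilon> M)"
  unfolding initial_submodule_eq_span_homog[OF assms]
  by (rule graded_submodule_span[OF UN_mono[OF subset_refl initial_forms_in_degree_homog]])

lemma initial_forms_in_degree_subset:
  "initial_forms_in_degree \<omega> \<epsilon> d M t \<subseteq> initial_submodule \<omega> \<epsilon> M \<inter> homog d t"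
  using initial_forms_in_degree_homog[of \<omega> \<epsilon> d M t]
  by (auto simp: initial_forms_in_degree_def initial_submodule_def intro: fmod.span_base)

text \<open>
  Multiplication by a monomial commutes with taking initial forms, so a multiple of an
  initial form that lands in degree \<open>a\<close> is the initial form of an element of degree \<open>a\<close>.
\<close>

lemma component_initial_submodule:
  fixes M :: "('n::finite, 'k::field) fvec set"
  assumes M: "graded_submodule d M"
  shows "component_submodule d (initial_submodule \<omega> \<epsilon> M) a =
    fmod.span (initial_forms_in_degree \<omega> \<epsilon> d M a)"
proof
  let ?I = "initial_forms_in_degree \<omega> \<epsilon> d M"
  let ?part = "\<lambda>t. terms_where (\<lambda>x. mon_deg d x = t)"
  have sub: "fmod.subspace M" using M by (rule subspace_graded)
  have shift: "fscale (Poly_Mapping.single v c) h \<in> fmod.span (?I (int (exp_deg v) + s))"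
    if "h \<in> fmod.span (?I s)" for v c h s
    using that
  proof (induction rule: fmod.span_induct_alt)
    case base
    show ?case by (simp add: fmod.span_zero)
  next
    case (step p g h)
    then obtain f where f: "f \<in> M" "f \<in> homog d s" "f \<noteq> 0" "g = initial_form \<omega> \<epsilon> f"
      by (auto simp: initial_forms_in_degree_def)
    let ?f = "fscale (Poly_Mapping.single v 1) f"
    have "?f \<in> M \<inter> homog d (int (exp_deg v) + s) - {0}"
      using f fmod.subspace_scale[OF sub] homog_fscale_single initial_form_fscale_monomial(2)
      by blast
    then have "initial_form \<omega> \<epsilon> ?f \<in> ?I (int (exp_deg v) + s)"
      by (auto simp: initial_forms_in_degree_def)
    then have "fscale (Poly_Mapping.single v 1) g \<in> ?I (int (exp_deg v) + s)"
      using f initial_form_fscale_monomial(1) by metis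
    then have "fscale (Poly_Mapping.single 0 c * p) (fscale (Poly_Mapping.single v 1) g)
        \<in> fmod.span (?I (int (exp_deg v) + s))"
      by (intro fmod.span_scale fmod.span_base)
    moreover have "fscale (Poly_Mapping.single 0 c * p) (fscale (Poly_Mapping.single v 1) g) =
        fscale (Poly_Mapping.single v c) (fscale p g)"
    proof -
      have "Poly_Mapping.single v c = Poly_Mapping.single 0 c * Poly_Mapping.single v 1"
        by (simp add: mult_single)
      then show ?thesis by (simp only: fmod.scale_scale ac_simps)
    qed
    ultimately show ?case using step by (simp add: fmod.scale_right_distrib fmod.span_add)
  qed
  let ?S = "{f. \<forall>t. ?part t f \<in> fmod.span (?I t)}"
  have "fmod.subspace ?S"
  proof (rule subspaceI_monomials)
    fix v c and f :: "('n, 'k) fvec" assume f: "f \<in> ?S"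
    let ?X = "fscale (Poly_Mapping.single v c) :: ('n, 'k) fvec \<Rightarrow> _"
    have "?part t (?X f) \<in> fmod.span (?I t)" for t
    proof -
      have "?part t (?X f) = ?X (?part (t - int (exp_deg v)) f)"
        unfolding terms_where_fscale_single
        by (rule arg_cong[where f = "fscale _"], rule terms_where_cong) (auto simp: mon_deg_shift)
      also have "\<dots> \<in> fmod.span (?I (int (exp_deg v) + (t - int (exp_deg v))))"
        using f by (intro shift) blast
      finally show ?thesis by (simp del: of_nat_sum)
    qed
    then show "?X f \<in> ?S" by blast
  qed (auto simp: terms_where_add fmod.span_zero fmod.span_add)
  moreover have "?I s \<subseteq> ?S" for s
  proof
    fix g assume g: "g \<in> ?I s"
    then have hom: "g \<in> homog d s" using initial_forms_in_degree_homog by blast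
    have "?part t g \<in> fmod.span (?I t)" for t
    proof (cases "s = t")
      case True
      then show ?thesis using g hom by (simp add: homog_part_self fmod.span_base)
    next
      case False
      then have "?part t g = 0" using hom by (intro terms_where_none) (auto simp: homog_iff)
      then show ?thesis by (simp only: fmod.span_zero)
    qed
    then show "g \<in> ?S" by blast
  qed
  ultimately have "initial_submodule \<omega> \<epsilon> M \<subseteq> ?S"
    unfolding initial_submodule_eq_span_homog[OF M] by (intro fmod.span_minimal) blast
  then have "?part a f \<in> fmod.span (?I a)" if "f \<in> initial_submodule \<omega> \<epsilon> M" for f
    using that by blast
  then have "initial_submodule \<omega> \<epsilon> M \<inter> homog d a \<subseteq> fmod.span (?I a)"
    by (metis IntE homog_part_self subsetI)
  then show "component_submodule d (initial_submodule \<omega> \<epsilon> M) a \<subseteq> fmod.span (?I a)"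
    unfolding component_submodule_def by (intro fmod.span_minimal) auto
  show "fmod.span (?I a) \<subseteq> component_submodule d (initial_submodule \<omega> \<epsilon> M) a"
    unfolding component_submodule_def
    by (intro fmod.span_mono initial_forms_in_degree_subset)
qed

section \<open>Lifting syzygies of initial forms\<close>

text \<open>
  The vectors \<open>hs\<close> have degree \<open>a\<close>; the free module with basis degrees \<open>e\<close> and basis weights \<open>w\<close>
  is mapped to \<open>free_mod d\<close> by \<open>lincomb hs\<close> and, through the initial forms, by \<open>lincomb gs\<close>. The
  second map respects degree and weight; the first one has the second one as its top weight part.
\<close>

locale initial_form_lifts =
  fixes \<omega> :: "'n::finite \<Rightarrow> nat" and \<epsilon> :: "nat list" and d :: "int list" and a :: int
    and hs :: "('n, 'k::field) fvec list"
  assumes hs_homog: "i < length hs \<Longrightarrow> hs ! i \<in> homog d a"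
begin

definition gs :: "('n, 'k) fvec list" where "gs = map (initial_form \<omega> \<epsilon>) hs"
definition e :: "int list" where "e = replicate (length hs) a"
definition w :: "nat list" where "w = map (\<lambda>h. Max (mon_weight \<omega> \<epsilon> ` monoms h)) hs"

abbreviation target_part :: "nat \<Rightarrow> ('n, 'k) fvec \<Rightarrow> ('n, 'k) fvec" where
  "target_part W \<equiv> terms_where (\<lambda>x. mon_weight \<omega> \<epsilon> x = W)"
abbreviation source_part :: "nat \<Rightarrow> ('n, 'k) fvec \<Rightarrow> ('n, 'k) fvec" where
  "source_part W \<equiv> terms_where (\<lambda>x. mon_weight \<omega> w x = W)"

text \<open>Strict bounds let the inductions on weights start at the zero vector.\<close>

definition target_below :: "nat \<Rightarrow> ('n, 'k) fvec set" where
  "target_below W = {f. \<forall>x\<in>monoms f. mon_weight \<omega> \<epsilon> x < W}"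
definition source_below :: "nat \<Rightarrow> ('n, 'k) fvec set" where
  "source_below W = {f \<in> free_mod e. \<forall>x\<in>monoms f. mon_weight \<omega> w x < W}"

lemma length_simps [simp]: "length gs = length hs" "length e = length hs" "length w = length hs"
  by (simp_all add: gs_def e_def w_def)

lemma hs_homog_e: "\<forall>i<length hs. hs ! i \<in> homog d (e ! i)"
  by (simp add: e_def hs_homog)

lemma gs_homog_e: "\<forall>i<length gs. gs ! i \<in> homog d (e ! i)"
  by (simp add: e_def gs_def hs_homog homog_initial_form)

lemma hs_weight:
  assumes "i < length hs" "(j, v) \<in> monoms (hs ! i)"
  shows "mon_weight \<omega> \<epsilon> (j, v) \<le> w ! i"
  using assms finite_monoms[of "hs ! i"] by (simp add: w_def)

lemma gs_nth: "i < length hs \<Longrightarrow> gs ! i = target_part (w ! i) (hs ! i)"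
  by (simp add: gs_def w_def initial_form_def)

lemma source_weight_shift: "mon_weight \<omega> w (i, u) = (\<Sum>k\<in>UNIV. \<omega> k * Poly_Mapping.lookup u k) + w ! i"
  by (simp add: mon_weight.simps)

lemma gs_weight:
  assumes "i < length hs" "(j, v) \<in> monoms (gs ! i)"
  shows "mon_weight \<omega> \<epsilon> (j, u + v) = mon_weight \<omega> w (i, u)"
  using assms by (simp add: gs_nth monoms_terms_where mon_weight_shift source_weight_shift)

lemma target_part_lincomb_gs: "target_part W (lincomb gs x) = lincomb gs (source_part W x)"
  by (rule terms_where_lincomb) (simp add: gs_weight)

lemma target_below_lincomb_hs:
  assumes "x \<in> source_below W"
  shows "lincomb hs x \<in> target_below W"
proof -
  have "monoms (lincomb hs x) \<subseteq> {y. mon_weight \<omega> \<epsilon> y < W}"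
  proof (rule monoms_lincomb)
    fix i u j v assume "(i, u) \<in> monoms x" "i < length hs" "(j, v) \<in> monoms (hs ! i)"
    then show "(j, u + v) \<in> {y. mon_weight \<omega> \<epsilon> y < W}"
      using assms hs_weight[of i j v]
      by (force simp: source_below_def mon_weight_shift source_weight_shift)
  qed
  then show ?thesis unfolding target_below_def by blast
qed

lemma target_part_lincomb_hs:
  assumes "x \<in> source_below (Suc W)"
  shows "target_part W (lincomb hs x) = lincomb gs (source_part W x)"
proof -
  define rs where "rs = map (\<lambda>h. h - initial_form \<omega> \<epsilon> h) hs"
  have "lincomb hs x = lincomb gs x + lincomb rs x"
    by (simp add: lincomb_def rs_def gs_def fmod.scale_right_diff_distrib flip: sum.distrib)
  moreover have "target_part W (lincomb rs x) = 0"
  proof (rule terms_where_none)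
    have "monoms (lincomb rs x) \<subseteq> {y. mon_weight \<omega> \<epsilon> y < W}"
    proof (rule monoms_lincomb)
      fix i u j v assume *: "(i, u) \<in> monoms x" "i < length rs" "(j, v) \<in> monoms (rs ! i)"
      then have i: "i < length hs" by (simp add: rs_def)
      then have "rs ! i = hs ! i - target_part (w ! i) (hs ! i)"
        by (simp add: rs_def gs_def flip: gs_nth)
      then have "(j, v) \<in> monoms (hs ! i)" "mon_weight \<omega> \<epsilon> (j, v) \<noteq> w ! i"
        using *(3) by (auto simp: mem_monoms lookup_minus lookup_terms_where split: if_splits)
      then have "mon_weight \<omega> \<epsilon> (j, v) < w ! i" using hs_weight[OF i] by (simp add: le_neq_implies_less)
      moreover have "mon_weight \<omega> w (i, u) < Suc W" using * assms by (auto simp: source_below_def)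
      ultimately show "(j, u + v) \<in> {y. mon_weight \<omega> \<epsilon> y < W}"
        by (simp add: mon_weight_shift source_weight_shift)
    qed
    then show "\<not> mon_weight \<omega> \<epsilon> y = W" if "y \<in> monoms (lincomb rs x)" for y using that by auto
  qed
  ultimately show ?thesis by (simp add: terms_where_add target_part_lincomb_gs)
qed

lemma source_below_add: "x \<in> source_below W \<Longrightarrow> y \<in> source_below W \<Longrightarrow> x + y \<in> source_below W"
  using monoms_add[of x y] fmod.subspace_add[OF subspace_free_mod, of x e y]
  by (auto simp: source_below_def)

lemma source_below_zero: "0 \<in> source_below W"
  using fmod.subspace_0[OF subspace_free_mod, of e] by (simp add: source_below_def)

lemma source_below_mono: "V \<le> W \<Longrightarrow> source_below V \<subseteq> source_below W"
  by (auto simp: source_below_def)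

lemma source_below_drop_part:
  assumes "x \<in> source_below (Suc W)"
  shows "x - source_part W x \<in> source_below W"
proof -
  have "monoms (x - source_part W x) \<subseteq> {y \<in> monoms x. mon_weight \<omega> w y \<noteq> W}"
    by (auto simp: mem_monoms lookup_minus lookup_terms_where split: if_splits)
  moreover have "x - source_part W x \<in> free_mod e"
    using assms by (intro fmod.subspace_diff[OF subspace_free_mod] terms_where_free_mod)
      (auto simp: source_below_def)
  ultimately show ?thesis using assms by (force simp: source_below_def less_Suc_eq)
qed

lemma target_below_SucD:
  assumes "f \<in> target_below (Suc W)" "target_part W f = 0"
  shows "f \<in> target_below W"
proof -
  have "{x \<in> monoms f. mon_weight \<omega> \<epsilon> x = W} = {}"
    unfolding monoms_terms_where[symmetric] using assms(2) by simp
  then show ?thesis using assms(1) by (force simp: target_below_def less_Suc_eq)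
qed

lemma target_below_diff: "f \<in> target_below W \<Longrightarrow> g \<in> target_below W \<Longrightarrow> f - g \<in> target_below W"
  using monoms_diff[of f g] by (auto simp: target_below_def)

lemma initial_form_top:
  assumes "f \<in> target_below (Suc W)" "target_part W f \<noteq> 0"
  shows "initial_form \<omega> \<epsilon> f = target_part W f"
proof -
  have "monoms (target_part W f) \<noteq> {}" using assms(2) by simp
  then obtain x where x: "x \<in> monoms f" "mon_weight \<omega> \<epsilon> x = W"
    by (auto simp: monoms_terms_where)
  show ?thesis
    by (rule initial_form_eqI[OF _ x]) (use assms(1) in \<open>auto simp: target_below_def\<close>)
qed

lemma target_below_exists: "\<exists>W. f \<in> target_below W"
proof -
  have "mon_weight \<omega> \<epsilon> x < Suc (Max (mon_weight \<omega> \<epsilon> ` monoms f))" if "x \<in> monoms f" for x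
    using that finite_monoms[of f] by (simp add: less_Suc_eq_le)
  then show ?thesis unfolding target_below_def by blast
qed

lemma source_below_exists:
  assumes "x \<in> free_mod e"
  shows "\<exists>W. x \<in> source_below W"
proof -
  have "mon_weight \<omega> w y < Suc (Max (mon_weight \<omega> w ` monoms x))" if "y \<in> monoms x" for y
    using that finite_monoms[of x] by (simp add: less_Suc_eq_le)
  then show ?thesis using assms unfolding source_below_def by blast
qed

text \<open>
  In a degree where the initial forms of \<open>M\<close> are combinations of those of \<open>hs\<close>, division of
  an element by \<open>hs\<close> leaves no remainder, and no term of the quotients exceeds its weight.
\<close>

lemma reduction:
  assumes M: "fmod.subspace M" "set hs \<subseteq> M"
    and init: "initial_forms_in_degree \<omega> \<epsilon> d M t \<subseteq> fmod.span (set gs)"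
    and "f \<in> M" "f \<in> homog d t" "f \<in> target_below W"
  shows "\<exists>y\<in>source_below W. lincomb hs y = f"
  using assms(4-)
proof (induction W arbitrary: f)
  case 0
  then have "\<forall>x\<in>monoms f. mon_weight \<omega> \<epsilon> x < 0" by (simp only: target_below_def mem_Collect_eq)
  then have "monoms f = {}" by (meson all_not_in_conv not_less_zero)
  then show ?case using source_below_zero lincomb_zero by auto
next
  case (Suc W)
  show ?case
  proof (cases "target_part W f = 0")
    case True
    then show ?thesis
      using Suc.IH[of f] Suc.prems target_below_SucD source_below_mono[of W "Suc W"] by auto
  next
    case False
    then have "f \<noteq> 0" by auto
    then have "initial_form \<omega> \<epsilon> f \<in> initial_forms_in_degree \<omega> \<epsilon> d M t"
      using Suc.prems(1,2) by (simp add: initial_forms_in_degree_def)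
    then have "target_part W f \<in> fmod.span (set gs)"
      using init initial_form_top[OF Suc.prems(3) False] by auto
    then have "target_part W f \<in> lincomb gs ` free_mod e"
      using lincomb_image[of e gs] by simp
    then obtain x where x: "x \<in> free_mod e" "lincomb gs x = target_part W f" by auto
    define y where "y = terms_where (\<lambda>x. mon_deg e x = t) (source_part W x)"
    have y_free: "y \<in> free_mod e" and y_homog: "y \<in> homog e t"
      using x(1) unfolding y_def by (auto intro: terms_where_free_mod homog_part)
    have y_part: "source_part W y = y"
      by (rule terms_where_id) (simp add: y_def monoms_terms_where)
    then have y_below: "y \<in> source_below (Suc W)"
      using y_free by (auto simp: source_below_def y_def monoms_terms_where)
    have "lincomb gs y = terms_where (\<lambda>x. mon_deg d x = t) (lincomb gs (source_part W x))"
      unfolding y_def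
      by (rule terms_where_lincomb[symmetric]) (simp add: mon_deg_lincomb[OF gs_homog_e])
    also have "lincomb gs (source_part W x) = target_part W f"
      using x(2) by (simp add: target_part_lincomb_gs[symmetric] terms_where_terms_where)
    also have "terms_where (\<lambda>x. mon_deg d x = t) \<dots> = target_part W f"
      using Suc.prems(2) by (intro homog_part_self homog_terms_where)
    finally have y_gs: "lincomb gs y = target_part W f" .
    have "target_part W (f - lincomb hs y) = 0"
      using target_part_lincomb_hs[OF y_below] by (simp add: terms_where_diff y_part y_gs)
    moreover have "f - lincomb hs y \<in> target_below (Suc W)"
      using Suc.prems(3) target_below_lincomb_hs[OF y_below] by (rule target_below_diff)
    ultimately have "f - lincomb hs y \<in> target_below W" by (rule target_below_SucD[rotated])
    moreover have "f - lincomb hs y \<in> homog d t"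
      using Suc.prems(2) homog_lincomb[OF hs_homog_e y_homog] by (rule homog_diff)
    moreover have "lincomb hs y \<in> fmod.span (set hs)"
      using lincomb_image[of e hs] y_free by auto
    then have "lincomb hs y \<in> M" using fmod.span_minimal[OF M(2,1)] by blast
    then have "f - lincomb hs y \<in> M" using Suc.prems(1) by (intro fmod.subspace_diff[OF M(1)])
    ultimately obtain z where z: "z \<in> source_below W" "lincomb hs z = f - lincomb hs y"
      using Suc.IH by blast
    have "z + y \<in> source_below (Suc W)"
      using z(1) y_below source_below_mono[of W "Suc W"] by (intro source_below_add) auto
    moreover have "lincomb hs (z + y) = f" using z(2) by (simp add: lincomb_add)
    ultimately show ?thesis by blast
  qed
qed

text \<open>
  Every syzygy of the initial forms lifts: each weight part \<open>W\<close> of it has, under \<open>lincomb hs\<close>, the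
  same value as some vector of weight below \<open>W\<close>. The vectors with this property form a
  submodule, so it suffices to reduce the generators of the syzygies, which have small degree.
\<close>

lemma syzygies_lift:
  assumes M: "fmod.subspace M" "set hs \<subseteq> M"
    and init: "\<forall>t\<in>{a..b}. initial_forms_in_degree \<omega> \<epsilon> d M t \<subseteq> fmod.span (set gs)"
    and syz: "syzygies e gs \<subseteq> fmod.span (\<Union>t\<in>{..b}. syzygies e gs \<inter> homog e t)"
    and x: "x \<in> syzygies e gs"
  shows "\<exists>z\<in>source_below W. lincomb hs z = lincomb hs (source_part W x)"
proof -
  let ?T = "{x. \<forall>W. \<exists>z\<in>source_below W. lincomb hs z = lincomb hs (source_part W x)}"
  have "fmod.subspace ?T"
  proof (rule subspaceI_monomials)
    show "0 \<in> ?T" using source_below_zero by auto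
  next
    fix f g assume fg: "f \<in> ?T" "g \<in> ?T"
    have "\<exists>z\<in>source_below W. lincomb hs z = lincomb hs (source_part W (f + g))" for W
    proof -
      obtain y z where "y \<in> source_below W" "lincomb hs y = lincomb hs (source_part W f)"
          "z \<in> source_below W" "lincomb hs z = lincomb hs (source_part W g)"
        using fg by blast
      then show ?thesis
        by (intro bexI[of _ "y + z"]) (simp_all add: lincomb_add terms_where_add source_below_add)
    qed
    then show "f + g \<in> ?T" by blast
  next
    fix v and c :: 'k and f :: "('n, 'k) fvec" assume f: "f \<in> ?T"
    let ?X = "fscale (Poly_Mapping.single v c) :: ('n, 'k) fvec \<Rightarrow> _"
    let ?n = "\<Sum>i\<in>UNIV. \<omega> i * Poly_Mapping.lookup v i"
    have "\<exists>z\<in>source_below W. lincomb hs z = lincomb hs (source_part W (?X f))" for W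
    proof (cases "?n \<le> W")
      case True
      then have part: "source_part W (?X f) = ?X (source_part (W - ?n) f)"
        unfolding terms_where_fscale_single
        by (intro arg_cong[where f = "fscale _"] terms_where_cong) (auto simp: mon_weight_shift)
      obtain z where z: "z \<in> source_below (W - ?n)"
          "lincomb hs z = lincomb hs (source_part (W - ?n) f)"
        using f by blast
      have "?X z \<in> source_below W"
        using z(1) True monoms_fscale_single[of v c z]
          fmod.subspace_scale[OF subspace_free_mod, of z e]
        by (fastforce simp: source_below_def mon_weight_shift)
      moreover have "lincomb hs (?X z) = lincomb hs (source_part W (?X f))"
        using z(2) by (simp add: part lincomb_scale)
      ultimately show ?thesis by blast
    next
      case False
      then have "source_part W (?X f) = 0"
        using monoms_fscale_single[of v c f]
        by (intro terms_where_none) (auto simp: mon_weight_shift)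
      then show ?thesis using source_below_zero by auto
    qed
    then show "?X f \<in> ?T" by blast
  qed
  moreover have "syzygies e gs \<inter> homog e t \<subseteq> ?T" if t: "t \<le> b" for t
  proof
    fix x assume x: "x \<in> syzygies e gs \<inter> homog e t"
    have "\<exists>z\<in>source_below W. lincomb hs z = lincomb hs (source_part W x)" for W
    proof -
      define y where "y = source_part W x"
      have y: "y \<in> free_mod e" "y \<in> homog e t"
        using x by (auto simp: y_def intro: terms_where_free_mod homog_terms_where)
      have part: "source_part W y = y"
        by (rule terms_where_id) (simp add: y_def monoms_terms_where)
      have below: "y \<in> source_below (Suc W)"
        using y(1) by (auto simp: source_below_def y_def monoms_terms_where)
      show ?thesis
      proof (cases "a \<le> t")
        case True
        let ?f = "lincomb hs y"
        have "target_part W ?f = lincomb gs y"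
          using target_part_lincomb_hs[OF below] by (simp only: part)
        also have "\<dots> = target_part W (lincomb gs x)"
          by (simp only: y_def target_part_lincomb_gs)
        finally have "target_part W ?f = target_part W (lincomb gs x)" .
        then have "target_part W ?f = 0" using x by simp
        then have f_below: "?f \<in> target_below W"
          by (rule target_below_SucD[OF target_below_lincomb_hs[OF below]])
        have f_homog: "?f \<in> homog d t" using homog_lincomb[OF hs_homog_e y(2)] .
        have "?f \<in> fmod.span (set hs)"
          using lincomb_image[of e hs] y(1) by auto
        then have f_M: "?f \<in> M" using fmod.span_minimal[OF M(2,1)] by blast
        show ?thesis
          using reduction[OF M _ f_M f_homog f_below] init True t by (simp add: y_def)
      next
        case False
        have "mon_deg e x \<ge> a" if "x \<in> monoms y" for x
        proof -
          obtain i u where iu: "x = (i, u)" by fastforce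
          then have "i < length hs" using that y(2) by (auto simp: homog_iff)
          then show ?thesis using iu by (simp add: mon_deg.simps e_def del: of_nat_sum)
        qed
        then have "monoms y = {}" using y(2) False by (fastforce simp: homog_iff)
        then show ?thesis using source_below_zero by (auto simp: y_def)
      qed
    qed
    then show "x \<in> ?T" by blast
  qed
  then have "(\<Union>t\<in>{..b}. syzygies e gs \<inter> homog e t) \<subseteq> ?T" by blast
  ultimately have "syzygies e gs \<subseteq> ?T"
    using syz fmod.span_minimal by (metis (no_types, lifting) order_trans)
  then show ?thesis using x by blast
qed

text \<open>
  Buchberger's criterion: if a representation of an element by \<open>hs\<close> has larger weight than
  the element, then its top part is a syzygy of the initial forms; lifting this syzygy lowers the
  weight of the representation.
\<close>

lemma initial_form_lincomb_in_span:
  assumes M: "fmod.subspace M" "set hs \<subseteq> M"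
    and init: "\<forall>t\<in>{a..b}. initial_forms_in_degree \<omega> \<epsilon> d M t \<subseteq> fmod.span (set gs)"
    and syz: "syzygies e gs \<subseteq> fmod.span (\<Union>t\<in>{..b}. syzygies e gs \<inter> homog e t)"
    and "f \<in> fmod.span (set hs)" "f \<noteq> 0"
  shows "initial_form \<omega> \<epsilon> f \<in> fmod.span (set gs)"
proof -
  have "initial_form \<omega> \<epsilon> (lincomb hs x) \<in> fmod.span (set gs)"
    if "x \<in> source_below W" "lincomb hs x \<noteq> 0" for x W
    using that
  proof (induction W arbitrary: x)
    case 0
    then have "\<forall>y\<in>monoms x. mon_weight \<omega> w y < 0" unfolding source_below_def by blast
    then have "monoms x = {}" by (meson all_not_in_conv not_less_zero)
    then show ?case using 0 by (simp add: lincomb_zero)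
  next
    case (Suc W)
    let ?y = "source_part W x"
    have y: "?y \<in> free_mod e"
      using Suc.prems(1) by (auto simp: source_below_def intro: terms_where_free_mod)
    have part: "target_part W (lincomb hs x) = lincomb gs ?y"
      by (rule target_part_lincomb_hs[OF Suc.prems(1)])
    show ?case
    proof (cases "lincomb gs ?y = 0")
      case False
      then have "initial_form \<omega> \<epsilon> (lincomb hs x) = lincomb gs ?y"
        using initial_form_top[OF target_below_lincomb_hs[OF Suc.prems(1)]] part by simp
      then show ?thesis using lincomb_image[of e gs] y by auto
    next
      case True
      then have "?y \<in> syzygies e gs" using y by simp
      then obtain z where z: "z \<in> source_below W" "lincomb hs z = lincomb hs (source_part W ?y)"
        using syzygies_lift[OF M init syz] by blast
      let ?x = "(x - ?y) + z"
      have "?x \<in> source_below W"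
        using source_below_drop_part[OF Suc.prems(1)] z(1) by (rule source_below_add)
      moreover have "lincomb hs ?x = lincomb hs x"
        using z(2) by (simp add: lincomb_add lincomb_diff terms_where_terms_where)
      ultimately show ?thesis using Suc.IH[of ?x] Suc.prems(2) by simp
    qed
  qed
  moreover obtain x where x: "x \<in> free_mod e" "f = lincomb hs x"
    using assms(5) lincomb_image[of e hs] by auto
  moreover obtain W where "x \<in> source_below W" using source_below_exists[OF x(1)] by blast
  ultimately show ?thesis using assms(6) by blast
qed

end

section \<open>Componentwise regularity and the gap theorem\<close>

text \<open>
  The component in degree \<open>b\<close> is generated in degree \<open>b\<close>, so when it is nonzero its regularity
  is at least \<open>b\<close>.
\<close>

lemma componentwise_regular_nonneg:
  assumes reg: "componentwise_regular d N r" and f: "f \<in> N" "f \<in> homog d b" "f \<noteq> 0"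
  shows "0 \<le> r"
proof -
  obtain gs where gs: "minimal_generator_list d (fmod.span (N \<inter> homog d b)) (replicate (length gs) b) gs"
    using minimal_generator_list_exists_from[of "N \<inter> homog d b" d b] by blast
  have "f \<in> fmod.span (set gs)"
    using gs f fmod.span_base[of f "N \<inter> homog d b"] by (simp add: minimal_generator_list_def)
  then have "gs \<noteq> []" using f(3) by auto
  then have "b \<in> set (replicate (length gs) b)" by simp
  moreover have "regularity d (fmod.span (N \<inter> homog d b)) \<le> ereal (of_int (b + r))"
    using reg by (simp add: componentwise_regular_def component_submodule_def)
  ultimately have "b \<le> b + r" by (rule generator_degree_le_regularity[OF gs, rotated])
  then show ?thesis by simp
qed

text \<open>
  For a nonzero module the infimum that defines \<open>creg\<close> is either over the empty set
  or attained, because it ranges over integers bounded below.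
\<close>

lemma creg_cases:
  assumes N: "graded_submodule d N" and "N \<noteq> {0}"
  obtains (infinite) "creg d N = \<infinity>"
    | (finite) r where "componentwise_regular d N r" "creg d N = ereal (of_int r)"
proof (cases "\<exists>r. componentwise_regular d N r")
  case False
  then have "{ereal (of_int r) | r. componentwise_regular d N r} = {}" by blast
  then have "creg d N = \<infinity>" unfolding creg_def by (simp add: top_ereal_def)
  then show ?thesis by (rule infinite)
next
  case True
  have "\<exists>t. \<not> N \<inter> homog d t \<subseteq> {0}"
  proof (rule ccontr)
    assume "\<not> ?thesis"
    then have "N \<subseteq> {0}" by (intro graded_submodule_subset_if_homog[OF N]) auto
    moreover have "0 \<in> N" using fmod.subspace_0[OF subspace_graded[OF N]] .
    ultimately show False using assms(2) by blast
  qed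
  then have nonneg: "0 \<le> r" if "componentwise_regular d N r" for r
    using componentwise_regular_nonneg[OF that] by blast
  obtain n where n: "componentwise_regular d N (int n)"
      and least: "\<And>m. componentwise_regular d N (int m) \<Longrightarrow> n \<le> m"
  proof -
    have "\<exists>n. componentwise_regular d N (int n)"
      using True nonneg by (metis nonneg_int_cases)
    from that[OF LeastI_ex[OF this] Least_le] show ?thesis .
  qed
  have "creg d N = ereal (of_int (int n))"
    unfolding creg_def
  proof (rule antisym[OF Inf_lower Inf_greatest])
    fix x assume "x \<in> {ereal (of_int r) | r. componentwise_regular d N r}"
    then obtain r where r: "x = ereal (of_int r)" "componentwise_regular d N r" by blast
    then obtain m where "r = int m" using nonneg by (metis nonneg_int_cases)
    then show "ereal (of_int (int n)) \<le> x" using r least[of m] by simp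
  qed (use n in blast)
  then show ?thesis using finite n by blast
qed

lemma generated_in_degrees_leI:
  assumes "graded_submodule d N" "N \<subseteq> fmod.span (\<Union>t\<in>{..a}. N \<inter> homog d t)"
  shows "generated_in_degrees_le d N a"
proof -
  have "fmod.span (\<Union>t\<in>{..a}. N \<inter> homog d t) \<subseteq> N"
    using subspace_graded[OF assms(1)] by (intro fmod.span_minimal) auto
  then show ?thesis using assms(2) by (simp add: generated_in_degrees_le_def)
qed

text \<open>
  The regularity of the degree \<open>a\<close> component bounds the degrees of the syzygies that Buchberger's
  criterion has to lift by \<open>a + r + 1\<close>. Up to that degree the absence of minimal generators says
  that all initial forms already come from degree \<open>a\<close>.
\<close>

lemma initial_submodule_generated_if_gap:
  fixes M :: "('n::finite, 'k::field) fvec set"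
  assumes M: "graded_submodule d M" and gen: "generated_in_degrees_le d M a"
    and reg: "regularity d (component_submodule d (initial_submodule \<omega> \<epsilon> M) a)
      \<le> ereal (of_int (a + r))"
    and gap: "\<And>t. a < t \<Longrightarrow> t \<le> a + r + 1 \<Longrightarrow>
      \<not> has_minimal_generator_in_degree d (initial_submodule \<omega> \<epsilon> M) t"
  shows "generated_in_degrees_le d (initial_submodule \<omega> \<epsilon> M) a"
proof -
  let ?N = "initial_submodule \<omega> \<epsilon> M"
  let ?I = "initial_forms_in_degree \<omega> \<epsilon> d M"
  have N: "graded_submodule d ?N" by (rule graded_submodule_initial_submodule[OF M])
  have subM: "fmod.subspace M" by (rule subspace_graded[OF M])
  have comp: "fmod.span (?N \<inter> homog d a) = fmod.span (?I a)"
    using component_initial_submodule[OF M, of \<omega> \<epsilon> a] by (simp add: component_submodule_def)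
  obtain gs where gs: "set gs \<subseteq> ?I a"
      "minimal_generator_list d (fmod.span (?I a)) (replicate (length gs) a) gs"
    using minimal_generator_list_exists_from[OF initial_forms_in_degree_homog] by metis
  have "gs \<in> map (initial_form \<omega> \<epsilon>) ` lists (M \<inter> homog d a)"
    using gs(1) unfolding lists_image[symmetric] initial_forms_in_degree_def by auto
  then obtain hs where hs: "gs = map (initial_form \<omega> \<epsilon>) hs" "set hs \<subseteq> M \<inter> homog d a"
    by (auto simp: lists_eq_set)
  interpret L: initial_form_lifts \<omega> \<epsilon> d a hs
    using hs(2) nth_mem[of _ hs] by unfold_locales blast
  have Lgs: "L.gs = gs" and Le: "L.e = replicate (length gs) a"
    by (simp_all add: L.gs_def L.e_def hs(1))
  have span_gs: "fmod.span (set gs) = fmod.span (?I a)"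
    using gs(2) by (simp add: minimal_generator_list_def)
  have hsM: "set hs \<subseteq> M" using hs(2) by blast
  have init: "\<forall>t\<in>{a..a + r + 1}. ?I t \<subseteq> fmod.span (set L.gs)"
  proof (intro ballI subsetI)
    fix t g assume t: "t \<in> {a..a + r + 1}" and "g \<in> ?I t"
    then have g: "g \<in> ?N" "g \<in> homog d t" using initial_forms_in_degree_subset by blast+
    have "?N \<inter> homog d t \<subseteq> fmod.span (\<Union>s\<in>{..a}. ?N \<inter> homog d s)"
      by (rule component_generated_in_lower_degrees[OF N gap]) (use t in auto)
    then have "g \<in> fmod.span (\<Union>s\<in>{..a}. ?N \<inter> homog d s)" using g by blast
    then have "g \<in> fmod.span (?N \<inter> homog d a)"
      using truncation_generated_by_component[OF N _ g(2)] t by simp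
    then show "g \<in> fmod.span (set L.gs)" by (simp add: Lgs span_gs comp)
  qed
  have "regularity d (fmod.span (?I a)) \<le> ereal (of_int (a + r))"
    using reg component_initial_submodule[OF M, of \<omega> \<epsilon> a] by simp
  from syzygies_generated_by_regularity[OF gs(2) this]
  have syz: "syzygies L.e L.gs \<subseteq> fmod.span (\<Union>t\<in>{..a + r + 1}. syzygies L.e L.gs \<inter> homog L.e t)"
    unfolding Lgs Le .
  \<comment> \<open>The initial forms of \<open>hs\<close> generate those of degree \<open>a\<close>, so division by \<open>hs\<close> succeeds there.\<close>
  have Ma: "M \<inter> homog d a \<subseteq> fmod.span (set hs)"
  proof
    fix f assume f: "f \<in> M \<inter> homog d a"
    obtain W where W: "f \<in> L.target_below W" using L.target_below_exists by blast
    have "?I a \<subseteq> fmod.span (set L.gs)"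
      unfolding Lgs span_gs by (rule fmod.span_superset)
    then obtain y where y: "y \<in> L.source_below W" "lincomb hs y = f"
      using L.reduction[OF subM hsM _ _ _ W] f by blast
    then show "f \<in> fmod.span (set hs)"
      using lincomb_image[of L.e hs] by (auto simp: L.source_below_def)
  qed
  have "?I t \<subseteq> fmod.span (\<Union>t\<in>{..a}. ?N \<inter> homog d t)" for t
  proof (cases "t \<le> a")
    case True
    then show ?thesis
      using initial_forms_in_degree_subset[of \<omega> \<epsilon> d M t] by (blast intro: fmod.span_base)
  next
    case False
    show ?thesis
    proof
      fix g assume "g \<in> ?I t"
      then obtain f where f: "f \<in> M" "f \<in> homog d t" "f \<noteq> 0" "g = initial_form \<omega> \<epsilon> f"
        by (auto simp: initial_forms_in_degree_def)
      have "f \<in> fmod.span (\<Union>s\<in>{..a}. M \<inter> homog d s)"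
        using gen f(1) by (simp add: generated_in_degrees_le_def)
      then have "f \<in> fmod.span (M \<inter> homog d a)"
        using truncation_generated_by_component[OF M _ f(2)] False by simp
      then have "f \<in> fmod.span (set hs)"
        using fmod.span_minimal[OF Ma] by blast
      then have "g \<in> fmod.span (set L.gs)"
        using L.initial_form_lincomb_in_span[OF subM hsM init syz] f(3,4) by blast
      then have "g \<in> fmod.span (?N \<inter> homog d a)" by (simp add: Lgs span_gs comp)
      moreover have "fmod.span (?N \<inter> homog d a) \<subseteq> fmod.span (\<Union>t\<in>{..a}. ?N \<inter> homog d t)"
        by (rule fmod.span_mono) blast
      ultimately show "g \<in> fmod.span (\<Union>t\<in>{..a}. ?N \<inter> homog d t)" by blast
    qed
  qed
  then have "(\<Union>t. ?I t) \<subseteq> fmod.span (\<Union>t\<in>{..a}. ?N \<inter> homog d t)" by blast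
  then have "fmod.span (\<Union>t. ?I t) \<subseteq> fmod.span (\<Union>t\<in>{..a}. ?N \<inter> homog d t)"
    by (rule fmod.span_minimal) simp
  then show ?thesis
    using initial_submodule_eq_span_homog[OF M, of \<omega> \<epsilon>] by (intro generated_in_degrees_leI[OF N]) simp
qed

theorem theorem5p2:
  fixes \<omega> :: "'n::finite \<Rightarrow> nat"
    and d :: "int list" and \<epsilon> :: "nat list"
    and M :: "('n, 'k::field) fvec set"
    and a :: int
  assumes "length \<epsilon> = length d"
    and "graded_submodule d M"
    and "finitely_generated M"
    and "generated_in_degrees_le d M a"
    and "\<forall>t::int. a + 1 \<le> t \<and>
           ereal (of_int t) \<le> ereal (of_int (a + 1)) + creg d (initial_submodule \<omega> \<epsilon> M) \<longrightarrow>
           \<not> has_minimal_generator_in_degree d (initial_submodule \<omega> \<epsilon> M) t"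
  shows "generated_in_degrees_le d (initial_submodule \<omega> \<epsilon> M) a"
proof -
  let ?N = "initial_submodule \<omega> \<epsilon> M"
  have N: "graded_submodule d ?N" by (rule graded_submodule_initial_submodule[OF assms(2)])
  show ?thesis
  proof (cases "?N = {0}")
    case True
    then show ?thesis by (intro generated_in_degrees_leI[OF N]) (simp add: fmod.span_zero)
  next
    case False
    from N False show ?thesis
    proof (cases rule: creg_cases)
      case infinite
      have "\<not> has_minimal_generator_in_degree d ?N t" if "a < t" for t
        using assms(5) that infinite by simp
      then have "?N \<inter> homog d t \<subseteq> fmod.span (\<Union>s\<in>{..a}. ?N \<inter> homog d s)" for t
        using component_generated_in_lower_degrees[OF N, of a t t] by blast
      then have "?N \<subseteq> fmod.span (\<Union>s\<in>{..a}. ?N \<inter> homog d s)"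
        by (intro graded_submodule_subset_if_homog[OF N]) simp_all
      then show ?thesis by (rule generated_in_degrees_leI[OF N])
    next
      case (finite r)
      have "regularity d (component_submodule d ?N a) \<le> ereal (of_int (a + r))"
        using finite(1) unfolding componentwise_regular_def by blast
      moreover have "\<not> has_minimal_generator_in_degree d ?N t" if "a < t" "t \<le> a + r + 1" for t
      proof -
        have "real_of_int t \<le> of_int (a + 1) + of_int r" using that(2) by linarith
        then show ?thesis using assms(5) that(1) finite(2) by simp
      qed
      ultimately show ?thesis
        by (rule initial_submodule_generated_if_gap[OF assms(2,4)])
    qed
  qed
qed

end
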